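(* Let $\lambda\in(0,1)$ and let $Q=(\lambda^{|i-j|})_{i,j=1}^n\in\mathbb{R}^{n\times n}$ be the one-dimensional Wasserstein-1 metric matrix. Let $L$ be the strictly lower triangular part of $Q$, so that $Q=I+L+L^T$. Then the following hold: (i) If $\lambda\le \frac13$, then every eigenvalue $\alpha$ of $Q$ satisfies $0<\alpha<2$. (ii) Every eigenvalue $\alpha$ of $Q$ satisfies $0<\alpha\le 1+2\|L\|_2\cos\left(\frac{\pi}{n+1}\right)$. (iii) $\rho(Q)\ge 1+\lambda$. (iv) $W(Q)\subset \left(0,\ \frac{(1+\lambda)(1-\lambda^{n-1})}{1-\lambda}\right]$. (v) $\frac{1}{(1+\lambda)^2}\le \|Q\|_\infty=\|Q\|_1\le 1+\frac{2\lambda(1-\lambda^{n-1})}{1-\lambda}$. (vi) $\frac{1}{(1+\lambda)^2}\le \|Q\|_2\le \min\left\{1+2\|L\|_2,\ \frac{3-\lambda}{1-\lambda},\ \frac{2(1+\lambda)(1-\lambda^{n-1})}{1-\lambda}\right\}$. (vii) $\|Q^{-1}\|_\infty=\|Q^{-1}\|_1\ge \frac{1-\lambda}{(1+\lambda)(1-\lambda^n)^2}$. (viii) $\frac{1-\lambda}{1+\lambda}\le \|Q^{-1}\|_2\le \frac{1+\lambda}{1-\lambda}$. (ix) $\frac{1-\lambda}{(1+\lambda)^3(1-\lambda^n)^2}\le \kappa_\infty(Q)=\kappa_1(Q)\le \frac{(1+\lambda)\left(1-\lambda+2\lambda(1-\lambda^{n-1})\right)}{(1-\lambda)^2}$. (x)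 $\frac{1-\lambda}{(1+\lambda)^3}\le \kappa_2(Q)\le \frac{1+\lambda}{1-\lambda}\cdot\min\left\{1+2\|L\|_2,\ \frac{3-\lambda}{1-\lambda},\ \frac{2(1+\lambda)(1-\lambda^{n-1})}{1-\lambda}\right\}$.
   Context: The one-dimensional Wasserstein-1 metric matrix is $Q=(q_{ij})\in\mathbb{R}^{n\times n}$ with $q_{ij}=\lambda^{|i-j|}$, where $\lambda=e^{-h/\varepsilon}$ with grid size $h>0$ and regularization parameter $\varepsilon>0$, i.e. $\lambda\in(0,1)$. It is known that $Q$ is symmetric positive definite, hence invertible. $L=(l_{ij})$ has $l_{ij}=\lambda^{i-j}$ for $i>j$ and $l_{ij}=0$ otherwise. $\|\cdot\|_1,\|\cdot\|_2,\|\cdot\|_\infty$ are the operator norms of a matrix induced by the corresponding vector norms (maximum absolute column sum, spectral norm, maximum absolute row sum). For $\#\in\{1,2,\infty\}$ and $A$ nonsingular, $\kappa_\#(A)=\|A\|_\#\|A^{-1}\|_\#$. $\rho(A)$ is the spectral radius. $W(A)=\{x^*Ax: x\in\mathbb{C}^n,\ \|x\|_2=1\}$ is the numerical range.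
   Formalization: The formal theorem assumes n ≥ 2; for n = 1 one has Q = [1] and the statement is false, since (iii) would say 1 ≥ 1+λ, the interval in (iv) is empty, and (vi) would bound ‖Q‖₂ = 1 by 0. *)

theory Defs
  imports Complex_Main "Jordan_Normal_Form.Spectral_Radius"
    "Jordan_Normal_Form.Gauss_Jordan_Elimination"
begin

definition vnorm1 :: "'a :: real_normed_vector vec \<Rightarrow> real" where
  "vnorm1 v = (\<Sum>i<dim_vec v. norm (v $ i))"

definition vnorm2 :: "'a :: real_normed_vector vec \<Rightarrow> real" where
  "vnorm2 v = sqrt (\<Sum>i<dim_vec v. (norm (v $ i))\<^sup>2)"

(* Inserting 0 only matters for the empty vector; norms are nonnegative. *)
definition vnorm_inf :: "'a :: real_normed_vector vec \<Rightarrow> real" where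
  "vnorm_inf v = Max (insert 0 {norm (v $ i) | i. i < dim_vec v})"

definition op_norm :: "(real vec \<Rightarrow> real) \<Rightarrow> real mat \<Rightarrow> real" where
  "op_norm nu A =
     (SUP x \<in> carrier_vec (dim_col A) - {0\<^sub>v (dim_col A)}. nu (A *\<^sub>v x) / nu x)"

abbreviation mnorm1 :: "real mat \<Rightarrow> real" where "mnorm1 \<equiv> op_norm vnorm1"
abbreviation mnorm2 :: "real mat \<Rightarrow> real" where "mnorm2 \<equiv> op_norm vnorm2"
abbreviation mnorm_inf :: "real mat \<Rightarrow> real" where "mnorm_inf \<equiv> op_norm vnorm_inf"

(* Meaningful for nonsingular A only: otherwise mat_inverse A = None. *)
definition mat_inv :: "real mat \<Rightarrow> real mat" where
  "mat_inv A = the (mat_inverse A)"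

definition cond_num :: "(real vec \<Rightarrow> real) \<Rightarrow> real mat \<Rightarrow> real" where
  "cond_num nu A = op_norm nu A * op_norm nu (mat_inv A)"

abbreviation cond1 :: "real mat \<Rightarrow> real" where "cond1 \<equiv> cond_num vnorm1"
abbreviation cond2 :: "real mat \<Rightarrow> real" where "cond2 \<equiv> cond_num vnorm2"
abbreviation cond_inf :: "real mat \<Rightarrow> real" where "cond_inf \<equiv> cond_num vnorm_inf"

(* (A *\<^sub>v x) \<bullet>c x conjugates its second argument, so it is x^* A x. *)
definition numerical_range :: "complex mat \<Rightarrow> complex set" where
  "numerical_range A =
     {(A *\<^sub>v x) \<bullet>c x | x. x \<in> carrier_vec (dim_col A) \<and> vnorm2 x = 1}"

definition wasserstein_mat :: "nat \<Rightarrow> real \<Rightarrow> real mat" where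
  "wasserstein_mat n lam = mat n n (\<lambda>(i, j). lam ^ nat \<bar>int i - int j\<bar>)"

definition strict_lower :: "real mat \<Rightarrow> real mat" where
  "strict_lower A = mat (dim_row A) (dim_col A) (\<lambda>(i, j). if j < i then A $$ (i, j) else 0)"

lemma strict_lower_wasserstein_mat:
  "strict_lower (wasserstein_mat n lam) =
     mat n n (\<lambda>(i, j). if j < i then lam ^ (i - j) else 0)"
  by (rule eq_matI) (auto simp: strict_lower_def wasserstein_mat_def nat_diff_distrib)

lemma wasserstein_mat_decomp:
  fixes n :: nat and lam :: real
  defines "L \<equiv> strict_lower (wasserstein_mat n lam)"
  shows "wasserstein_mat n lam = 1\<^sub>m n + L + transpose_mat L"
proof (rule eq_matI)
  fix i j
  assume "i < dim_row (1\<^sub>m n + L + transpose_mat L)"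
    and "j < dim_col (1\<^sub>m n + L + transpose_mat L)"
  then have "i < n" "j < n"
    by (auto simp: L_def strict_lower_wasserstein_mat)
  then show "wasserstein_mat n lam $$ (i, j) = (1\<^sub>m n + L + transpose_mat L) $$ (i, j)"
    unfolding L_def strict_lower_wasserstein_mat
    by (cases i j rule: linorder_cases) (auto simp: wasserstein_mat_def nat_diff_distrib abs_if)
qed (auto simp: L_def strict_lower_def wasserstein_mat_def)

end

(*
  With s_i = sum_{j <= i} lam^(i-j) x_j one has x^T Q x = sum_i (s_i^2 - (lam s_{i-1})^2), which
  yields x^T Q x >= (1 - lam)/(1 + lam) |x|^2 and hence the bound on the inverse in the spectral
  norm. The upper bounds on Q come from its row sums via the Schur test, those on the inverse from
  its explicit tridiagonal form. The cosine in (ii) is the Haagerup--de la Harpe bound for the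
  nilpotent matrix L: x^T L^k x are the coefficients of a nonnegative cosine polynomial, to which
  Fejer's coefficient inequality applies. For (iii), Q expands e_1 + e_2 by at least 1 + lam.
*)
theory Submission
  imports Defs "HOL-Analysis.L2_Norm"
begin

text \<open>The spectrum and the numerical range are complex, yet every estimate is real: since
  \<open>Q\<close> is real and symmetric, its form at a complex vector is the sum of the real forms
  at the real and imaginary parts. A two-sided bound on the real form therefore confines numerical
  range and eigenvalues at once, and shows that they are real. The constants (1 - lam)/(1 + lam) and
  (1 + lam)/(1 - lam) are the minimum and maximum of (1 - lam^2)/(1 - 2 lam cos t + lam^2), the
  symbol of the bi-infinite Toeplitz matrix with entries lam^|i-j|; the second is also its full row
  sum, so the finite row sums stay strictly below it. All lower bounds on norms are read off from a
  single entry: 1 on the diagonal of \<open>Q\<close>, and 1/(1 - lam^2) in the corner of its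
  inverse.\<close>

lemma square_sum_mult_le:
  fixes f g :: "'a \<Rightarrow> real"
  shows "(\<Sum>i\<in>I. f i * g i)\<^sup>2 \<le> (\<Sum>i\<in>I. (f i)\<^sup>2) * (\<Sum>i\<in>I. (g i)\<^sup>2)"
proof -
  have "\<bar>\<Sum>i\<in>I. f i * g i\<bar> \<le> L2_set f I * L2_set g I"
    by (intro order_trans[OF sum_abs] order_trans[OF _ L2_set_mult_ineq]) (simp add: abs_mult)
  then have "\<bar>\<Sum>i\<in>I. f i * g i\<bar>\<^sup>2 \<le> (L2_set f I * L2_set g I)\<^sup>2"
    by (intro power_mono) auto
  then show ?thesis
    by (simp add: power_mult_distrib L2_set_def sum_nonneg)
qed

lemma mult_mat_vec_unit_vec:
  fixes A :: "'a :: semiring_1 mat"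
  assumes "A \<in> carrier_mat m n" "j < n"
  shows "A *\<^sub>v unit_vec n j = col A j"
  using assms by (intro eq_vecI) auto

lemma index_mult_mat_vec_sum:
  fixes A :: "'a :: comm_semiring_0 mat"
  assumes "A \<in> carrier_mat n m" "x \<in> carrier_vec m" "i < n"
  shows "(A *\<^sub>v x) $ i = (\<Sum>j<m. A $$ (i, j) * x $ j)"
  using assms by (auto simp: scalar_prod_def lessThan_atLeast0 intro!: sum.cong)

lemma quadratic_form_sum:
  fixes A :: "'a :: comm_semiring_0 mat"
  assumes "A \<in> carrier_mat n n" "x \<in> carrier_vec n"
  shows "x \<bullet> (A *\<^sub>v x) = (\<Sum>i<n. \<Sum>j<n. A $$ (i, j) * x $ i * x $ j)"
proof -
  have "x \<bullet> (A *\<^sub>v x) = (\<Sum>i<n. x $ i * (A *\<^sub>v x) $ i)"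
    using assms by (auto simp: scalar_prod_def lessThan_atLeast0)
  also have "\<dots> = (\<Sum>i<n. \<Sum>j<n. A $$ (i, j) * x $ i * x $ j)"
    using assms
    by (auto simp del: index_mult_mat_vec
        simp: index_mult_mat_vec_sum sum_distrib_left mult_ac intro!: sum.cong)
  finally show ?thesis .
qed

subsection \<open>Induced norms\<close>

lemma vnorm2_nonneg: "vnorm2 v \<ge> 0"
  by (auto simp: vnorm2_def intro!: sum_nonneg)

lemma vnorm_inf_set:
  "{norm (v $ i) | i. i < dim_vec v} = (\<lambda>i. norm (v $ i)) ` {..<dim_vec v}"
  by auto

lemma vnorm_inf_nonneg: "vnorm_inf v \<ge> 0"
  unfolding vnorm_inf_def vnorm_inf_set by (intro Max_ge) auto

lemma norm_le_vnorm_inf: "i < dim_vec v \<Longrightarrow> norm (v $ i) \<le> vnorm_inf v"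
  unfolding vnorm_inf_def vnorm_inf_set by (intro Max_ge) auto

lemma vnorm_inf_le: "c \<ge> 0 \<Longrightarrow> (\<And>i. i < dim_vec v \<Longrightarrow> norm (v $ i) \<le> c) \<Longrightarrow> vnorm_inf v \<le> c"
  unfolding vnorm_inf_def vnorm_inf_set by (subst Max_le_iff) auto

lemma vnorm2_sq: "(vnorm2 x)\<^sup>2 = (\<Sum>i<dim_vec x. (norm (x $ i))\<^sup>2)"
  unfolding vnorm2_def by (intro real_sqrt_pow2 sum_nonneg) auto

lemma vnorm2_sq_real:
  fixes x :: "real vec"
  assumes "x \<in> carrier_vec n"
  shows "(vnorm2 x)\<^sup>2 = x \<bullet> x" "x \<bullet> x = (\<Sum>i<n. (x $ i)\<^sup>2)"
  using assms by (auto simp: vnorm2_sq scalar_prod_def lessThan_atLeast0 power2_eq_square[of "x $ _"])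

lemma vnorm_pos:
  fixes x :: "real vec"
  assumes "x \<in> carrier_vec n" "x \<noteq> 0\<^sub>v n"
  shows "vnorm1 x > 0" "vnorm2 x > 0" "vnorm_inf x > 0"
proof -
  obtain i where i: "i < n" "x $ i \<noteq> 0"
    using assms by (metis carrier_vecD eq_vecI index_zero_vec)
  then show "vnorm1 x > 0" "vnorm2 x > 0"
    using assms by (auto simp: vnorm1_def vnorm2_def intro!: sum_pos2[of _ i])
  show "vnorm_inf x > 0"
    using norm_le_vnorm_inf[of i x] i assms by auto
qed

lemma cauchy_schwarz_vnorm2:
  fixes x y :: "real vec"
  assumes "x \<in> carrier_vec n" "y \<in> carrier_vec n"
  shows "x \<bullet> y \<le> vnorm2 x * vnorm2 y"
proof -
  have "(x \<bullet> y)\<^sup>2 \<le> (vnorm2 x * vnorm2 y)\<^sup>2"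
    using square_sum_mult_le[of "($) x" "($) y" "{..<n}"] assms
    by (simp add: power_mult_distrib vnorm2_sq scalar_prod_def lessThan_atLeast0)
  then show ?thesis
    by (rule power2_le_imp_le) (simp add: vnorm2_nonneg)
qed

text \<open>Positivity of \<open>nu\<close> is the only norm property used, so the three vector
  norms share this lemma. With \<open>n > 0\<close> there is a nonzero vector, and the supremum is
  not over the empty set.\<close>

lemma op_norm_le:
  assumes "A \<in> carrier_mat m n" "n > 0"
    and pos: "\<And>x. x \<in> carrier_vec n \<Longrightarrow> x \<noteq> 0\<^sub>v n \<Longrightarrow> nu x > 0"
    and le: "\<And>x. x \<in> carrier_vec n \<Longrightarrow> nu (A *\<^sub>v x) \<le> c * nu x"
  shows "op_norm nu A \<le> c"
  unfolding op_norm_def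
proof (rule cSUP_least)
  have "unit_vec n 0 \<in> carrier_vec n - {0\<^sub>v n :: real vec}"
    using \<open>n > 0\<close> unit_vec_nonzero[of n 0] by auto
  then show "carrier_vec (dim_col A) - {0\<^sub>v (dim_col A) :: real vec} \<noteq> {}"
    using assms(1) by blast
qed (use assms in \<open>auto simp: divide_le_eq\<close>)

text \<open>The constant \<open>c\<close> certifies that the quotients are bounded above; without
  that, \<open>SUP\<close> on the reals need not dominate its members. It may be as crude as one
  likes.\<close>

lemma op_norm_ge:
  assumes "A \<in> carrier_mat m n"
    and pos: "\<And>x. x \<in> carrier_vec n \<Longrightarrow> x \<noteq> 0\<^sub>v n \<Longrightarrow> nu x > 0"
    and le: "\<And>x. x \<in> carrier_vec n \<Longrightarrow> nu (A *\<^sub>v x) \<le> c * nu x"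
    and x: "x \<in> carrier_vec n" "x \<noteq> 0\<^sub>v n"
  shows "nu (A *\<^sub>v x) \<le> op_norm nu A * nu x"
proof -
  have "nu (A *\<^sub>v x) / nu x \<le> op_norm nu A"
    unfolding op_norm_def
  proof (rule cSUP_upper)
    show "bdd_above ((\<lambda>x. nu (A *\<^sub>v x) / nu x) ` (carrier_vec (dim_col A) - {0\<^sub>v (dim_col A)}))"
      using assms by (intro bdd_aboveI2[where M = c]) (auto simp: divide_le_eq)
  qed (use assms in auto)
  then show ?thesis
    using pos[OF x] by (simp add: divide_le_eq)
qed

text \<open>Split each entry a as sqrt |a| times sgn a * sqrt |a| and apply Cauchy-Schwarz within a
  row: the first factor produces a row sum, bounded by \<open>R\<close>, and summing the second over
  all rows produces column sums, bounded by \<open>C\<close>.\<close>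

lemma schur_test:
  fixes A :: "real mat"
  assumes A: "A \<in> carrier_mat m n" and x: "x \<in> carrier_vec n"
    and R: "\<And>i. i < m \<Longrightarrow> (\<Sum>j<n. \<bar>A $$ (i, j)\<bar>) \<le> R"
    and C: "\<And>j. j < n \<Longrightarrow> (\<Sum>i<m. \<bar>A $$ (i, j)\<bar>) \<le> C"
    and "R \<ge> 0"
  shows "(vnorm2 (A *\<^sub>v x))\<^sup>2 \<le> R * C * (vnorm2 x)\<^sup>2"
proof -
  have row: "(\<Sum>j<n. A $$ (i, j) * x $ j)\<^sup>2 \<le> R * (\<Sum>j<n. \<bar>A $$ (i, j)\<bar> * (x $ j)\<^sup>2)"
    if i: "i < m" for i
  proof -
    have "(\<Sum>j<n. A $$ (i, j) * x $ j)\<^sup>2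
        = (\<Sum>j<n. sqrt \<bar>A $$ (i, j)\<bar> * (sgn (A $$ (i, j)) * sqrt \<bar>A $$ (i, j)\<bar> * x $ j))\<^sup>2"
      by (intro arg_cong[where f = "\<lambda>t. t\<^sup>2"] sum.cong)
        (auto simp: sgn_if)
    also have "\<dots> \<le> (\<Sum>j<n. (sqrt \<bar>A $$ (i, j)\<bar>)\<^sup>2)
          * (\<Sum>j<n. (sgn (A $$ (i, j)) * sqrt \<bar>A $$ (i, j)\<bar> * x $ j)\<^sup>2)"
      by (rule square_sum_mult_le)
    also have "\<dots> = (\<Sum>j<n. \<bar>A $$ (i, j)\<bar>) * (\<Sum>j<n. \<bar>A $$ (i, j)\<bar> * (x $ j)\<^sup>2)"
      by (intro arg_cong2[where f = "(*)"] sum.cong)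
        (auto simp: power_mult_distrib sgn_if)
    also have "\<dots> \<le> R * (\<Sum>j<n. \<bar>A $$ (i, j)\<bar> * (x $ j)\<^sup>2)"
      using R[OF i] by (intro mult_right_mono sum_nonneg) auto
    finally show ?thesis .
  qed
  have "(vnorm2 (A *\<^sub>v x))\<^sup>2 = (\<Sum>i<m. (\<Sum>j<n. A $$ (i, j) * x $ j)\<^sup>2)"
    using A x by (simp add: vnorm2_sq index_mult_mat_vec_sum del: index_mult_mat_vec)
  also have "\<dots> \<le> (\<Sum>i<m. R * (\<Sum>j<n. \<bar>A $$ (i, j)\<bar> * (x $ j)\<^sup>2))"
    by (intro sum_mono row) auto
  also have "\<dots> = R * (\<Sum>j<n. (\<Sum>i<m. \<bar>A $$ (i, j)\<bar>) * (x $ j)\<^sup>2)"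
    by (subst sum_distrib_left[symmetric], subst sum.swap) (simp add: sum_distrib_right)
  also have "\<dots> \<le> R * (\<Sum>j<n. C * (x $ j)\<^sup>2)"
    using C \<open>R \<ge> 0\<close> by (intro mult_left_mono sum_mono mult_right_mono) auto
  also have "\<dots> = R * C * (vnorm2 x)\<^sup>2"
    using x by (simp add: vnorm2_sq sum_distrib_left mult_ac)
  finally show ?thesis .
qed

lemma vnorm1_mult_le:
  fixes A :: "real mat"
  assumes A: "A \<in> carrier_mat m n" and x: "x \<in> carrier_vec n"
    and C: "\<And>j. j < n \<Longrightarrow> (\<Sum>i<m. \<bar>A $$ (i, j)\<bar>) \<le> C"
  shows "vnorm1 (A *\<^sub>v x) \<le> C * vnorm1 x"
proof -
  have "vnorm1 (A *\<^sub>v x) = (\<Sum>i<m. \<bar>\<Sum>j<n. A $$ (i, j) * x $ j\<bar>)"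
    using A x by (simp add: vnorm1_def index_mult_mat_vec_sum del: index_mult_mat_vec)
  also have "\<dots> \<le> (\<Sum>i<m. \<Sum>j<n. \<bar>A $$ (i, j)\<bar> * \<bar>x $ j\<bar>)"
    by (intro sum_mono order_trans[OF sum_abs]) (simp add: abs_mult)
  also have "\<dots> = (\<Sum>j<n. (\<Sum>i<m. \<bar>A $$ (i, j)\<bar>) * \<bar>x $ j\<bar>)"
    by (subst sum.swap) (simp add: sum_distrib_right)
  also have "\<dots> \<le> (\<Sum>j<n. C * \<bar>x $ j\<bar>)"
    using C by (intro sum_mono mult_right_mono) auto
  also have "\<dots> = C * vnorm1 x"
    using x by (simp add: vnorm1_def sum_distrib_left)
  finally show ?thesis .
qed

lemma vnorm_inf_mult_le:
  fixes A :: "real mat"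
  assumes A: "A \<in> carrier_mat m n" and x: "x \<in> carrier_vec n"
    and R: "\<And>i. i < m \<Longrightarrow> (\<Sum>j<n. \<bar>A $$ (i, j)\<bar>) \<le> R" and "R \<ge> 0"
  shows "vnorm_inf (A *\<^sub>v x) \<le> R * vnorm_inf x"
proof (rule vnorm_inf_le)
  show "R * vnorm_inf x \<ge> 0"
    using \<open>R \<ge> 0\<close> by (simp add: vnorm_inf_nonneg)
  fix i assume "i < dim_vec (A *\<^sub>v x)"
  then have i: "i < m" using A by simp
  have "norm ((A *\<^sub>v x) $ i) = \<bar>\<Sum>j<n. A $$ (i, j) * x $ j\<bar>"
    using A x i by (simp add: index_mult_mat_vec_sum del: index_mult_mat_vec)
  also have "\<dots> \<le> (\<Sum>j<n. \<bar>A $$ (i, j)\<bar> * \<bar>x $ j\<bar>)"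
    by (intro order_trans[OF sum_abs]) (simp add: abs_mult)
  also have "\<dots> \<le> (\<Sum>j<n. \<bar>A $$ (i, j)\<bar> * vnorm_inf x)"
    using x norm_le_vnorm_inf[of _ x] by (intro sum_mono mult_left_mono) auto
  also have "\<dots> = (\<Sum>j<n. \<bar>A $$ (i, j)\<bar>) * vnorm_inf x"
    by (simp add: sum_distrib_right)
  also have "\<dots> \<le> R * vnorm_inf x"
    using R[OF i] by (intro mult_right_mono vnorm_inf_nonneg)
  finally show "norm ((A *\<^sub>v x) $ i) \<le> R * vnorm_inf x" .
qed

text \<open>The total of all absolute entries serves below as the crude constant that
  \<open>op_norm_ge\<close> asks for.\<close>

lemma row_sum_le_total:
  fixes A :: "real mat"
  shows "i < m \<Longrightarrow> (\<Sum>j<n. \<bar>A $$ (i, j)\<bar>) \<le> (\<Sum>i<m. \<Sum>j<n. \<bar>A $$ (i, j)\<bar>)"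
  by (rule member_le_sum[of i "{..<m}" "\<lambda>i. \<Sum>j<n. \<bar>A $$ (i, j)\<bar>"]) (auto intro: sum_nonneg)

lemma col_sum_le_total:
  fixes A :: "real mat"
  shows "j < n \<Longrightarrow> (\<Sum>i<m. \<bar>A $$ (i, j)\<bar>) \<le> (\<Sum>i<m. \<Sum>j<n. \<bar>A $$ (i, j)\<bar>)"
  by (subst sum.swap, rule member_le_sum[of j "{..<n}" "\<lambda>j. \<Sum>i<m. \<bar>A $$ (i, j)\<bar>"])
    (auto intro: sum_nonneg)

lemma mnorm2_le:
  assumes "A \<in> carrier_mat m n" "n > 0"
    and "\<And>x. x \<in> carrier_vec n \<Longrightarrow> vnorm2 (A *\<^sub>v x) \<le> c * vnorm2 x"
  shows "mnorm2 A \<le> c"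
  using assms vnorm_pos by (intro op_norm_le[of A m n vnorm2]) auto

lemma vnorm2_mult_le_mnorm2:
  assumes A: "A \<in> carrier_mat m n" and x: "x \<in> carrier_vec n"
  shows "vnorm2 (A *\<^sub>v x) \<le> mnorm2 A * vnorm2 x"
proof (cases "x = 0\<^sub>v n")
  case True
  have "A *\<^sub>v x = 0\<^sub>v m"
    using A True by auto
  then show ?thesis
    using True by (simp add: vnorm2_def)
next
  case False
  define F where "F = (\<Sum>i<m. \<Sum>j<n. \<bar>A $$ (i, j)\<bar>)"
  have F: "F \<ge> 0"
    unfolding F_def by (intro sum_nonneg) auto
  have "vnorm2 (A *\<^sub>v x) \<le> F * vnorm2 x" if "x \<in> carrier_vec n" for x
  proof -
    have "(vnorm2 (A *\<^sub>v x))\<^sup>2 \<le> F * F * (vnorm2 x)\<^sup>2"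
      using F by (intro schur_test[OF A that])
        (auto simp: F_def row_sum_le_total col_sum_le_total)
    then have "(vnorm2 (A *\<^sub>v x))\<^sup>2 \<le> (F * vnorm2 x)\<^sup>2"
      by (simp add: power2_eq_square mult_ac)
    then show ?thesis
      by (rule power2_le_imp_le) (simp add: F vnorm2_nonneg)
  qed
  then show ?thesis
    using vnorm_pos False x by (intro op_norm_ge[OF A]) auto
qed

lemma mnorm2_nonneg:
  assumes "A \<in> carrier_mat m n" "n > 0"
  shows "mnorm2 A \<ge> 0"
proof -
  have u: "unit_vec n 0 \<in> carrier_vec n" "unit_vec n 0 \<noteq> (0\<^sub>v n :: real vec)"
    using assms unit_vec_nonzero[of n 0] by auto
  have "0 \<le> mnorm2 A * vnorm2 (unit_vec n 0 :: real vec)"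
    using vnorm2_mult_le_mnorm2[OF assms(1) u(1)] vnorm2_nonneg order_trans by blast
  then show ?thesis
    using vnorm_pos(2)[OF u] by (simp add: zero_le_mult_iff)
qed

text \<open>Unit vectors pick out the columns and attain the column sums. Describing the norm by its
  upper bounds avoids a maximum over columns, and two norms with the same upper bounds are
  equal.\<close>

lemma mnorm1_le_iff:
  assumes A: "A \<in> carrier_mat m n" "n > 0"
  shows "mnorm1 A \<le> c \<longleftrightarrow> (\<forall>j<n. (\<Sum>i<m. \<bar>A $$ (i, j)\<bar>) \<le> c)"
proof
  assume c: "mnorm1 A \<le> c"
  show "\<forall>j<n. (\<Sum>i<m. \<bar>A $$ (i, j)\<bar>) \<le> c"
  proof (intro allI impI)
    fix j assume j: "j < n"
    have "vnorm1 (A *\<^sub>v unit_vec n j) \<le> mnorm1 A * vnorm1 (unit_vec n j :: real vec)"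
      using vnorm_pos unit_vec_nonzero[of n j] j
      by (intro op_norm_ge[OF A(1), where c = "\<Sum>i<m. \<Sum>j<n. \<bar>A $$ (i, j)\<bar>"])
        (auto intro!: vnorm1_mult_le[OF A(1)] col_sum_le_total)
    moreover have "A *\<^sub>v unit_vec n j = col A j"
      using A(1) j by (rule mult_mat_vec_unit_vec)
    moreover have "vnorm1 (unit_vec n j :: real vec) = 1"
      using j by (simp add: vnorm1_def unit_vec_def if_distrib cong: if_cong)
    ultimately show "(\<Sum>i<m. \<bar>A $$ (i, j)\<bar>) \<le> c"
      using A c j by (simp add: vnorm1_def)
  qed
next
  assume "\<forall>j<n. (\<Sum>i<m. \<bar>A $$ (i, j)\<bar>) \<le> c"
  then show "mnorm1 A \<le> c"
    using A vnorm_pos by (intro op_norm_le[OF A]) (auto intro!: vnorm1_mult_le[OF A(1)])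
qed

lemma mnorm_inf_le_iff:
  assumes A: "A \<in> carrier_mat m n" "n > 0" "m > 0"
  shows "mnorm_inf A \<le> c \<longleftrightarrow> (\<forall>i<m. (\<Sum>j<n. \<bar>A $$ (i, j)\<bar>) \<le> c)"
proof
  assume c: "mnorm_inf A \<le> c"
  show "\<forall>i<m. (\<Sum>j<n. \<bar>A $$ (i, j)\<bar>) \<le> c"
  proof (intro allI impI)
    fix i assume i: "i < m"
    \<comment> \<open>The sign pattern of row \<open>i\<close> turns the product with that row into
      its absolute sum. Zero entries get sign 1, so that \<open>x\<close> is nonzero and has norm
      exactly 1.\<close>
    define x where "x = vec n (\<lambda>j. if A $$ (i, j) \<ge> 0 then 1 else - 1 :: real)"
    have x: "x \<in> carrier_vec n" "x $ 0 \<noteq> (0\<^sub>v n :: real vec) $ 0"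
      using A by (auto simp: x_def)
    have "(\<Sum>j<n. \<bar>A $$ (i, j)\<bar>) = (A *\<^sub>v x) $ i"
      unfolding index_mult_mat_vec_sum[OF A(1) x(1) i]
      by (intro sum.cong) (auto simp: x_def)
    also have "\<dots> \<le> vnorm_inf (A *\<^sub>v x)"
      using norm_le_vnorm_inf[of i "A *\<^sub>v x"] A i by simp
    also have "\<dots> \<le> mnorm_inf A * vnorm_inf x"
      using vnorm_pos x
      by (intro op_norm_ge[OF A(1), where c = "\<Sum>i<m. \<Sum>j<n. \<bar>A $$ (i, j)\<bar>"])
        (auto intro!: vnorm_inf_mult_le[OF A(1)] row_sum_le_total sum_nonneg)
    also have "vnorm_inf x = 1"
      using norm_le_vnorm_inf[of 0 x] A
      by (intro antisym vnorm_inf_le) (auto simp: x_def split: if_splits)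
    finally show "(\<Sum>j<n. \<bar>A $$ (i, j)\<bar>) \<le> c"
      using c by simp
  qed
next
  assume *: "\<forall>i<m. (\<Sum>j<n. \<bar>A $$ (i, j)\<bar>) \<le> c"
  \<comment> \<open>\<open>vnorm_inf_mult_le\<close> needs a nonnegative bound; row 0, which exists
    because \<open>m > 0\<close>, forces \<open>c\<close> to be one.\<close>
  have "0 \<le> (\<Sum>j<n. \<bar>A $$ (0, j)\<bar>)"
    by (intro sum_nonneg) auto
  also have "\<dots> \<le> c" using * A by auto
  finally show "mnorm_inf A \<le> c"
    using A * vnorm_pos by (intro op_norm_le[OF A(1,2)]) (auto intro!: vnorm_inf_mult_le[OF A(1)])
qed

lemma mnorm_inf_eq_mnorm1:
  assumes A: "A \<in> carrier_mat n n" "n > 0"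
    and sym: "\<And>i j. i < n \<Longrightarrow> j < n \<Longrightarrow> A $$ (i, j) = A $$ (j, i)"
  shows "mnorm_inf A = mnorm1 A"
proof -
  have "(\<Sum>j<n. \<bar>A $$ (i, j)\<bar>) = (\<Sum>j<n. \<bar>A $$ (j, i)\<bar>)" if "i < n" for i
    using that by (intro sum.cong arg_cong[where f = abs] sym) auto
  then have "mnorm_inf A \<le> c \<longleftrightarrow> mnorm1 A \<le> c" for c
    using A by (auto simp: mnorm1_le_iff mnorm_inf_le_iff)
  then show ?thesis
    by (intro antisym) auto
qed

lemma col_sum_le_mnorm1:
  assumes "A \<in> carrier_mat m n" "j < n"
  shows "(\<Sum>i<m. \<bar>A $$ (i, j)\<bar>) \<le> mnorm1 A"
  using mnorm1_le_iff[of A m n "mnorm1 A"] assms by auto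

text \<open>An entry is one coordinate of the image of a unit vector. All lower bounds in the
  spectral norm come from here.\<close>

lemma abs_entry_le_mnorm2:
  assumes A: "A \<in> carrier_mat m n" and ij: "i < m" "j < n"
  shows "\<bar>A $$ (i, j)\<bar> \<le> mnorm2 A"
proof -
  have "\<bar>A $$ (i, j)\<bar>\<^sup>2 \<le> (vnorm2 (A *\<^sub>v unit_vec n j))\<^sup>2"
    using A ij member_le_sum[of i "{..<m}" "\<lambda>i. (A $$ (i, j))\<^sup>2"]
    by (simp add: vnorm2_sq mult_mat_vec_unit_vec[OF A])
  then have "\<bar>A $$ (i, j)\<bar> \<le> vnorm2 (A *\<^sub>v unit_vec n j)"
    by (rule power2_le_imp_le) (rule vnorm2_nonneg)
  also have "\<dots> \<le> mnorm2 A * vnorm2 (unit_vec n j :: real vec)"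
    by (rule vnorm2_mult_le_mnorm2[OF A]) simp
  also have "vnorm2 (unit_vec n j :: real vec) = sqrt (\<Sum>i<n. if i = j then 1 else 0)"
    using ij unfolding vnorm2_def by (intro arg_cong[where f = sqrt] sum.cong) auto
  also have "\<dots> = 1"
    using ij by simp
  finally show ?thesis by simp
qed

subsection \<open>Nonnegative cosine polynomials and nilpotent contractions\<close>

text \<open>With a = k pi / m, multiplying by 2 sin a makes the sum telescope to sin (2 k pi) - sin
  0 = 0. The condition 0 < k < m keeps a inside (0, pi), so sin a can be cancelled.\<close>

lemma sum_cos_odd_multiples:
  assumes "0 < k" "k < m"
  shows "(\<Sum>j<m. cos (real k * (real (2 * j + 1) * pi / real m))) = 0"
proof -
  define a where "a = real k * pi / real m"
  have "0 < a" "a < pi"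
    using assms by (auto simp: a_def divide_less_eq)
  then have "sin a > 0"
    by (rule sin_gt_zero)
  have "2 * sin a * (\<Sum>j<m. cos (real k * (real (2 * j + 1) * pi / real m)))
      = (\<Sum>j<m. sin (real (2 * Suc j) * a) - sin (real (2 * j) * a))"
    unfolding sum_distrib_left
  proof (rule sum.cong[OF refl])
    fix j
    have "sin (real (2 * Suc j) * a) = sin (real (2 * j + 1) * a + a)"
      "sin (real (2 * j) * a) = sin (real (2 * j + 1) * a - a)"
      by (simp_all add: algebra_simps)
    moreover have "real k * (real (2 * j + 1) * pi / real m) = real (2 * j + 1) * a"
      by (simp add: a_def)
    ultimately show "2 * sin a * cos (real k * (real (2 * j + 1) * pi / real m))
        = sin (real (2 * Suc j) * a) - sin (real (2 * j) * a)"
      by (simp only: sin_add sin_diff) simp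
  qed
  also have "\<dots> = sin (real (2 * m) * a) - sin (real (2 * 0) * a)"
    by (rule sum_lessThan_telescope)
  also have "real (2 * m) * a = real (2 * k) * pi"
    using assms by (simp add: a_def)
  also have "sin (real (2 * k) * pi) - sin (real (2 * 0) * a) = 0"
    by (simp only: sin_npi) simp
  finally show ?thesis
    using \<open>sin a > 0\<close> by simp
qed

text \<open>The odd multiples of pi/m below 2 pi lie in [pi/m, 2 pi - pi/m]. This interval is
  symmetric about pi, and cosine is largest at its ends.\<close>

lemma cos_odd_multiple_le:
  assumes "j < m"
  shows "cos (real (2 * j + 1) * pi / real m) \<le> cos (pi / real m)"
proof -
  have m: "real m \<ge> 1" using assms by linarith
  define \<theta> where "\<theta> = real (2 * j + 1) * pi / real m"
  have lo: "pi / real m \<le> \<theta>"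
    using m by (auto simp: \<theta>_def field_simps)
  have "real (2 * j + 1) * pi \<le> (2 * real m - 1) * pi"
    using assms by (intro mult_right_mono) auto
  then have "\<theta> \<le> (2 * real m - 1) * pi / real m"
    unfolding \<theta>_def using m by (intro divide_right_mono) auto
  also have "\<dots> = 2 * pi - pi / real m"
    using m by (simp add: field_simps)
  finally have hi: "\<theta> \<le> 2 * pi - pi / real m" .
  have p: "0 \<le> pi / real m" by simp
  show ?thesis
  proof (cases "\<theta> \<le> pi")
    case True
    then show ?thesis
      using lo p unfolding \<theta>_def[symmetric] by (intro cos_monotone_0_pi_le) auto
  next
    case False
    have "cos (2 * pi - \<theta>) \<le> cos (pi / real m)"
      using False hi p by (intro cos_monotone_0_pi_le) auto
    then show ?thesis
      unfolding \<theta>_def[symmetric] by (simp add: cos_diff)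
  qed
qed

text \<open>
  The nodes \<open>(2j+1)\<pi>/(N+1)\<close> integrate cosine polynomials of degree at most \<open>N\<close> exactly, and
  \<open>cos \<theta> - cos (\<pi>/(N+1))\<close> is nonpositive at all of them.
\<close>
lemma fejer_coefficient_bound:
  fixes p :: "nat \<Rightarrow> real"
  assumes N: "N \<ge> 2"
    and nonneg: "\<And>\<theta>. p 0 + 2 * (\<Sum>k=1..<N. cos (real k * \<theta>) * p k) \<ge> 0"
  shows "p 1 \<le> cos (pi / (real N + 1)) * p 0"
proof -
  \<comment> \<open>The product of \<open>f\<close> and a cosine has degree \<open>N\<close>, and
    \<open>sum_cos_odd_multiples\<close> requires a frequency below the number of nodes. So
    \<open>N + 1\<close> is the least number that works, and it is the origin of the angle in the
    bound.\<close>
  define m where "m = Suc N"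
  define \<theta> where "\<theta> j = real (2 * j + 1) * pi / real m" for j
  define c where "c = cos (pi / real m)"
  define f where "f t = p 0 + 2 * (\<Sum>k=1..<N. cos (real k * t) * p k)" for t
  have f_nonneg: "f t \<ge> 0" for t
    unfolding f_def by (rule nonneg)
  have zero: "(\<Sum>j<m. cos (real k * \<theta> j)) = 0" if "0 < k" "k \<le> N" for k
    using sum_cos_odd_multiples[of k m] that by (simp add: \<theta>_def m_def)
  have prod: "2 * (\<Sum>j<m. cos (real k * \<theta> j) * cos (\<theta> j)) = (if k = 1 then real m else 0)"
    if k: "1 \<le> k" "k < N" for k
  proof -
    have "2 * (\<Sum>j<m. cos (real k * \<theta> j) * cos (\<theta> j))
        = (\<Sum>j<m. cos (real (k + 1) * \<theta> j) + cos (real (k - 1) * \<theta> j))"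
      unfolding sum_distrib_left
    proof (rule sum.cong[OF refl])
      fix j
      have "real (k + 1) * \<theta> j = real k * \<theta> j + \<theta> j" "real (k - 1) * \<theta> j = real k * \<theta> j - \<theta> j"
        using k by (simp_all add: algebra_simps of_nat_diff)
      then show "2 * (cos (real k * \<theta> j) * cos (\<theta> j))
          = cos (real (k + 1) * \<theta> j) + cos (real (k - 1) * \<theta> j)"
        by (simp only: cos_add cos_diff)
    qed
    also have "\<dots> = (\<Sum>j<m. cos (real (k - 1) * \<theta> j))"
      using zero[of "k + 1"] k by (simp add: sum.distrib)
    also have "\<dots> = (if k = 1 then real m else 0)"
      using zero[of "k - 1"] k by auto
    finally show ?thesis .
  qed
  \<comment> \<open>Evaluated exactly, the right-hand side is m (p 1 - c p 0). The frequency 1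
    occurs in \<open>f\<close> because \<open>N \<ge> 2\<close>.\<close>
  have "0 \<ge> (\<Sum>j<m. f (\<theta> j) * (cos (\<theta> j) - c))"
    using cos_odd_multiple_le
    by (intro sum_nonpos mult_nonneg_nonpos f_nonneg) (auto simp: \<theta>_def c_def)
  also have "(\<Sum>j<m. f (\<theta> j) * (cos (\<theta> j) - c))
      = (\<Sum>j<m. f (\<theta> j) * cos (\<theta> j)) - c * (\<Sum>j<m. f (\<theta> j))"
    by (simp add: right_diff_distrib sum_subtractf sum_distrib_left mult_ac)
  also have "(\<Sum>j<m. f (\<theta> j)) = real m * p 0 + 2 * (\<Sum>k=1..<N. p k * (\<Sum>j<m. cos (real k * \<theta> j)))"
    unfolding f_def
    by (simp add: sum.distrib sum_distrib_left sum.swap[of _ "{..<m}"] mult_ac)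
  also have "(\<Sum>k=1..<N. p k * (\<Sum>j<m. cos (real k * \<theta> j))) = 0"
    using zero by (intro sum.neutral) auto
  also have "(\<Sum>j<m. f (\<theta> j) * cos (\<theta> j))
      = p 0 * (\<Sum>j<m. cos (real 1 * \<theta> j))
        + (\<Sum>k=1..<N. p k * (2 * (\<Sum>j<m. cos (real k * \<theta> j) * cos (\<theta> j))))"
    unfolding f_def distrib_right sum.distrib
    by (simp add: sum_distrib_left sum_distrib_right sum.swap[of _ "{..<m}"] mult_ac)
  also have "(\<Sum>k=1..<N. p k * (2 * (\<Sum>j<m. cos (real k * \<theta> j) * cos (\<theta> j))))
      = (\<Sum>k=1..<N. if k = 1 then real m * p k else 0)"
    using prod by (intro sum.cong) auto
  also have "\<dots> = real m * p 1"
    using N by simp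
  finally have "real m * p 1 \<le> real m * (c * p 0)"
    using zero[of 1] N by (simp add: mult_ac)
  then show ?thesis
    by (simp add: m_def c_def add.commute)
qed

text \<open>
  With \<open>y = (I - zA)\<^sup>-\<^sup>1 x\<close> and \<open>z = exp (i\<theta>)\<close>, the sum below is \<open>\<bar>y\<bar>\<^sup>2 - \<bar>A y\<bar>\<^sup>2\<close>;
  here \<open>u\<close> and \<open>v\<close> are the real and imaginary parts of \<open>y\<close>.
\<close>
lemma nilpotent_contraction_poisson:
  fixes A :: "real mat"
  assumes A: "A \<in> carrier_mat n n"
    and contr: "\<And>y. y \<in> carrier_vec n \<Longrightarrow> vnorm2 (A *\<^sub>v y) \<le> vnorm2 y"
    and X: "\<And>k. X k \<in> carrier_vec n" "\<And>k. X (Suc k) = A *\<^sub>v X k" "X N = 0\<^sub>v n"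
    and N: "N \<ge> 1"
  shows "X 0 \<bullet> X 0 + 2 * (\<Sum>k=1..<N. cos (real k * \<theta>) * (X 0 \<bullet> X k)) \<ge> 0"
proof -
  define u where "u = vec n (\<lambda>i. \<Sum>k<N. cos (real k * \<theta>) * X k $ i)"
  define v where "v = vec n (\<lambda>i. \<Sum>k<N. sin (real k * \<theta>) * X k $ i)"
  have uv: "u \<in> carrier_vec n" "v \<in> carrier_vec n"
    by (simp_all add: u_def v_def)
  have lin: "(A *\<^sub>v vec n (\<lambda>i. \<Sum>k<N. g k * X k $ i)) $ i = (\<Sum>k<N. g k * X (Suc k) $ i)"
    if i: "i < n" for g i
  proof -
    have "(A *\<^sub>v vec n (\<lambda>i. \<Sum>k<N. g k * X k $ i)) $ i
        = (\<Sum>j<n. \<Sum>k<N. A $$ (i, j) * (g k * X k $ j))"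
      by (subst index_mult_mat_vec_sum[OF A _ i]) (auto simp: sum_distrib_left)
    also have "\<dots> = (\<Sum>k<N. g k * (\<Sum>j<n. A $$ (i, j) * X k $ j))"
      by (subst sum.swap) (simp add: sum_distrib_left mult_ac)
    also have "\<dots> = (\<Sum>k<N. g k * X (Suc k) $ i)"
      unfolding X(2) index_mult_mat_vec_sum[OF A X(1) i] ..
    finally show ?thesis .
  qed
  \<comment> \<open>Nilpotency enters here: the boundary term at \<open>N\<close> vanishes, so the
    finite Neumann sum y satisfies y = x + z A y exactly, where x is \<open>X 0\<close>.\<close>
  have shift: "(\<Sum>k<N. g (Suc k) * X (Suc k) $ i) = (\<Sum>k<N. g k * X k $ i) - g 0 * X 0 $ i"
    if "i < n" for g :: "nat \<Rightarrow> real" and i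
    using sum.lessThan_Suc_shift[of "\<lambda>k. g k * X k $ i" N] X(3) that by simp
  \<comment> \<open>As |z| = 1, the equation y - x = z A y gives |y - x| = |A y| in every
    coordinate. Expanding the square with x real leaves |y|^2 - |A y|^2 = 2 x Re y - x^2.\<close>
  have pointwise: "(u $ i)\<^sup>2 + (v $ i)\<^sup>2 - ((A *\<^sub>v u) $ i)\<^sup>2 - ((A *\<^sub>v v) $ i)\<^sup>2
      = 2 * (X 0 $ i * u $ i) - (X 0 $ i)\<^sup>2" if i: "i < n" for i
  proof -
    define a b where "a = (A *\<^sub>v u) $ i" and "b = (A *\<^sub>v v) $ i"
    have ab: "a = (\<Sum>k<N. cos (real k * \<theta>) * X (Suc k) $ i)"
      "b = (\<Sum>k<N. sin (real k * \<theta>) * X (Suc k) $ i)"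
      using i by (simp_all add: a_def b_def u_def v_def lin del: index_mult_mat_vec)
    have "(\<Sum>k<N. cos (real (Suc k) * \<theta>) * X (Suc k) $ i) = cos \<theta> * a - sin \<theta> * b"
      unfolding ab sum_distrib_left sum_subtractf[symmetric]
      by (intro sum.cong) (simp_all add: distrib_right cos_add algebra_simps)
    with shift[OF i, of "\<lambda>k. cos (real k * \<theta>)"] i
    have u: "u $ i = X 0 $ i + (cos \<theta> * a - sin \<theta> * b)"
      by (simp add: u_def)
    have "(\<Sum>k<N. sin (real (Suc k) * \<theta>) * X (Suc k) $ i) = sin \<theta> * a + cos \<theta> * b"
      unfolding ab sum_distrib_left sum.distrib[symmetric]
      by (intro sum.cong) (simp_all add: distrib_right sin_add algebra_simps)
    with shift[OF i, of "\<lambda>k. sin (real k * \<theta>)"] i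
    have v: "v $ i = sin \<theta> * a + cos \<theta> * b"
      by (simp add: v_def)
    have "(p * a - q * b)\<^sup>2 + (q * a + p * b)\<^sup>2 = (p\<^sup>2 + q\<^sup>2) * (a\<^sup>2 + b\<^sup>2)" for p q
      by (simp add: power2_eq_square algebra_simps)
    from this[of "cos \<theta>" "sin \<theta>"] have "(cos \<theta> * a - sin \<theta> * b)\<^sup>2 + (sin \<theta> * a + cos \<theta> * b)\<^sup>2 = a\<^sup>2 + b\<^sup>2"
      by simp
    moreover have "(t + p)\<^sup>2 + q\<^sup>2 - a\<^sup>2 - b\<^sup>2 = 2 * (t * (t + p)) - t\<^sup>2"
      if "p\<^sup>2 + q\<^sup>2 = a\<^sup>2 + b\<^sup>2" for t p q
      using that by (simp add: power2_eq_square algebra_simps)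
    ultimately show ?thesis
      unfolding a_def[symmetric] b_def[symmetric] u v by blast
  qed
  have "0 \<le> (vnorm2 u)\<^sup>2 + (vnorm2 v)\<^sup>2 - (vnorm2 (A *\<^sub>v u))\<^sup>2 - (vnorm2 (A *\<^sub>v v))\<^sup>2"
    using power_mono[OF contr[OF uv(1)] vnorm2_nonneg, of 2]
      power_mono[OF contr[OF uv(2)] vnorm2_nonneg, of 2] by simp
  also have "\<dots> = (\<Sum>i<n. (u $ i)\<^sup>2 + (v $ i)\<^sup>2 - ((A *\<^sub>v u) $ i)\<^sup>2 - ((A *\<^sub>v v) $ i)\<^sup>2)"
    using A uv by (simp add: vnorm2_sq sum.distrib sum_subtractf del: index_mult_mat_vec)
  also have "\<dots> = (\<Sum>i<n. 2 * (X 0 $ i * u $ i) - (X 0 $ i)\<^sup>2)"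
    by (intro sum.cong pointwise) auto
  also have "\<dots> = 2 * (\<Sum>i<n. X 0 $ i * u $ i) - X 0 \<bullet> X 0"
    by (simp add: sum_subtractf sum_distrib_left vnorm2_sq_real(2)[OF X(1)])
  also have "(\<Sum>i<n. X 0 $ i * u $ i) = (\<Sum>k<N. cos (real k * \<theta>) * (\<Sum>i<n. X 0 $ i * X k $ i))"
    by (simp add: u_def sum_distrib_left sum.swap[of _ "{..<n}"] mult_ac)
  also have "\<dots> = (\<Sum>k<N. cos (real k * \<theta>) * (X 0 \<bullet> X k))"
    by (simp add: scalar_prod_def lessThan_atLeast0 carrier_vecD[OF X(1)])
  also have "\<dots> = X 0 \<bullet> X 0 + (\<Sum>k=1..<N. cos (real k * \<theta>) * (X 0 \<bullet> X k))"
    using N by (simp add: lessThan_atLeast0 sum.atLeast_Suc_lessThan)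
  finally show ?thesis by simp
qed

text \<open>The real quadratic form case of the Haagerup--de la Harpe inequality.\<close>
lemma nilpotent_quadratic_form_le:
  fixes A :: "real mat"
  assumes A: "A \<in> carrier_mat n n" and x: "x \<in> carrier_vec n"
    and M: "M \<ge> 0" "\<And>y. y \<in> carrier_vec n \<Longrightarrow> vnorm2 (A *\<^sub>v y) \<le> M * vnorm2 y"
    and nil: "((\<lambda>v. A *\<^sub>v v) ^^ N) x = 0\<^sub>v n" and N: "N \<ge> 2"
  shows "x \<bullet> (A *\<^sub>v x) \<le> M * cos (pi / (real N + 1)) * (vnorm2 x)\<^sup>2"
proof (cases "M = 0")
  case True
  have "x \<bullet> (A *\<^sub>v x) \<le> vnorm2 x * vnorm2 (A *\<^sub>v x)"
    using A x by (intro cauchy_schwarz_vnorm2) auto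
  also have "\<dots> \<le> 0"
    using True M(2)[OF x] vnorm2_nonneg[of x] by (simp add: mult_nonneg_nonpos)
  finally show ?thesis
    using True by simp
next
  case False
  \<comment> \<open>Scaling by 1/M makes \<open>T\<close> a contraction, which is why M = 0 had to
    be separated. \<open>X k\<close> is T^k x, written through the powers of \<open>A\<close> so
    that \<open>nil\<close> applies directly.\<close>
  define T where "T = (1 / M) \<cdot>\<^sub>m A"
  define X where "X k = (1 / M) ^ k \<cdot>\<^sub>v ((\<lambda>v. A *\<^sub>v v) ^^ k) x" for k
  have T: "T \<in> carrier_mat n n"
    using A by (simp add: T_def)
  have T_mult: "T *\<^sub>v y = (1 / M) \<cdot>\<^sub>v (A *\<^sub>v y)" if "y \<in> carrier_vec n" for y
    using A that by (intro eq_vecI) (auto simp: T_def)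
  have vnorm2_smult: "vnorm2 (c \<cdot>\<^sub>v y) = \<bar>c\<bar> * vnorm2 y" for c and y :: "real vec"
    by (simp add: vnorm2_def power_mult_distrib sum_distrib_left[symmetric] real_sqrt_mult)
  have car: "((\<lambda>v. A *\<^sub>v v) ^^ k) x \<in> carrier_vec n" for k
    by (induction k) (use A x in auto)
  have "X 0 \<bullet> X 1 \<le> cos (pi / (real N + 1)) * (X 0 \<bullet> X 0)"
  proof (rule fejer_coefficient_bound[OF N])
    show "X 0 \<bullet> X 0 + 2 * (\<Sum>k=1..<N. cos (real k * \<theta>) * (X 0 \<bullet> X k)) \<ge> 0" for \<theta>
    proof (rule nilpotent_contraction_poisson[OF T])
      show "vnorm2 (T *\<^sub>v y) \<le> vnorm2 y" if "y \<in> carrier_vec n" for y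
        using M False that by (simp add: T_mult vnorm2_smult field_simps)
      show "X (Suc k) = T *\<^sub>v X k" for k
        using A car[of k] by (subst T_mult) (auto simp: X_def smult_smult_assoc)
      show "X N = 0\<^sub>v n"
        unfolding X_def nil by auto
    qed (use N car in \<open>auto simp: X_def\<close>)
  qed
  moreover have "X 0 = x" "X 1 = (1 / M) \<cdot>\<^sub>v (A *\<^sub>v x)"
    by (simp_all add: X_def)
  ultimately have "x \<bullet> (A *\<^sub>v x) / M \<le> cos (pi / (real N + 1)) * (vnorm2 x)\<^sup>2"
    using A x by (simp add: vnorm2_sq_real(1)[OF x])
  then show ?thesis
    using False M(1) by (simp add: divide_le_eq mult_ac)
qed

subsection \<open>Numerical range and spectrum of real matrices\<close>

text \<open>The imaginary part is a sum of cross terms Im x_j Re x_i - Re x_j Im x_i, antisymmetric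
  in i and j, so a symmetric weight annihilates it.\<close>

lemma complex_quadratic_form_symmetric:
  fixes A :: "real mat" and x :: "complex vec"
  assumes A: "A \<in> carrier_mat n n" and x: "x \<in> carrier_vec n"
    and sym: "\<And>i j. i < n \<Longrightarrow> j < n \<Longrightarrow> A $$ (i, j) = A $$ (j, i)"
  shows "(map_mat complex_of_real A *\<^sub>v x) \<bullet>c x
    = complex_of_real (map_vec Re x \<bullet> (A *\<^sub>v map_vec Re x) + map_vec Im x \<bullet> (A *\<^sub>v map_vec Im x))"
proof -
  have C: "map_mat complex_of_real A \<in> carrier_mat n n"
    using A by simp
  have "(map_mat complex_of_real A *\<^sub>v x) \<bullet>c x
      = (\<Sum>i<n. (map_mat complex_of_real A *\<^sub>v x) $ i * cnj (x $ i))"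
    using A x by (simp add: scalar_prod_def lessThan_atLeast0)
  also have "\<dots> = (\<Sum>i<n. \<Sum>j<n. complex_of_real (A $$ (i, j)) * x $ j * cnj (x $ i))"
    using A index_mult_mat_vec_sum[OF C x]
    by (simp add: sum_distrib_right del: index_mult_mat_vec)
  finally have eq: "(map_mat complex_of_real A *\<^sub>v x) \<bullet>c x
      = (\<Sum>i<n. \<Sum>j<n. complex_of_real (A $$ (i, j)) * x $ j * cnj (x $ i))" .
  have "(\<Sum>i<n. \<Sum>j<n. A $$ (i, j) * (Im (x $ j) * Re (x $ i)))
      = (\<Sum>i<n. \<Sum>j<n. A $$ (i, j) * (Re (x $ j) * Im (x $ i)))"
    by (subst sum.swap) (auto simp: mult_ac sym intro!: sum.cong)
  then have "(\<Sum>i<n. \<Sum>j<n. A $$ (i, j) * (Im (x $ j) * Re (x $ i) - Re (x $ j) * Im (x $ i))) = 0"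
    by (simp add: right_diff_distrib sum_subtractf)
  moreover have "map_vec Re x \<in> carrier_vec n" "map_vec Im x \<in> carrier_vec n"
    using x by auto
  moreover have "Re (complex_of_real t * z * cnj w) = t * Re w * Re z + t * Im w * Im z"
    "Im (complex_of_real t * z * cnj w) = t * (Im z * Re w - Re z * Im w)" for t z w
    by (simp_all add: algebra_simps)
  ultimately show ?thesis
    unfolding eq using x
    by (intro complex_eqI) (simp_all only: Re_sum Im_sum, simp_all add: quadratic_form_sum[OF A] sum.distrib)
qed

lemma vnorm2_sq_Re_Im: "(vnorm2 x)\<^sup>2 = (vnorm2 (map_vec Re x))\<^sup>2 + (vnorm2 (map_vec Im x))\<^sup>2"
  by (simp add: vnorm2_sq cmod_power2 sum.distrib)

lemma complex_quadratic_form_bounds: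
  fixes A :: "real mat" and x :: "complex vec"
  assumes A: "A \<in> carrier_mat n n" and x: "x \<in> carrier_vec n"
    and sym: "\<And>i j. i < n \<Longrightarrow> j < n \<Longrightarrow> A $$ (i, j) = A $$ (j, i)"
    and lo: "\<And>y. y \<in> carrier_vec n \<Longrightarrow> a * (vnorm2 y)\<^sup>2 \<le> y \<bullet> (A *\<^sub>v y)"
    and hi: "\<And>y. y \<in> carrier_vec n \<Longrightarrow> y \<bullet> (A *\<^sub>v y) \<le> b * (vnorm2 y)\<^sup>2"
  obtains r where "(map_mat complex_of_real A *\<^sub>v x) \<bullet>c x = complex_of_real r"
    "a * (vnorm2 x)\<^sup>2 \<le> r" "r \<le> b * (vnorm2 x)\<^sup>2"
proof -
  have "map_vec Re x \<in> carrier_vec n" "map_vec Im x \<in> carrier_vec n"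
    using x by auto
  from add_mono[OF lo[OF this(1)] lo[OF this(2)]] add_mono[OF hi[OF this(1)] hi[OF this(2)]]
  show thesis
    by (intro that[OF complex_quadratic_form_symmetric[OF A x sym]])
      (simp_all add: vnorm2_sq_Re_Im[of x] distrib_left)
qed

lemma numerical_range_symmetric:
  fixes A :: "real mat"
  assumes A: "A \<in> carrier_mat n n"
    and sym: "\<And>i j. i < n \<Longrightarrow> j < n \<Longrightarrow> A $$ (i, j) = A $$ (j, i)"
    and lo: "\<And>y. y \<in> carrier_vec n \<Longrightarrow> a * (vnorm2 y)\<^sup>2 \<le> y \<bullet> (A *\<^sub>v y)"
    and hi: "\<And>y. y \<in> carrier_vec n \<Longrightarrow> y \<bullet> (A *\<^sub>v y) \<le> b * (vnorm2 y)\<^sup>2"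
  shows "numerical_range (map_mat complex_of_real A) \<subseteq> complex_of_real ` {a..b}"
proof
  fix z assume "z \<in> numerical_range (map_mat complex_of_real A)"
  then obtain x where x: "x \<in> carrier_vec n" "vnorm2 x = 1"
      "z = (map_mat complex_of_real A *\<^sub>v x) \<bullet>c x"
    using A by (auto simp: numerical_range_def)
  then show "z \<in> complex_of_real ` {a..b}"
    by (auto intro: complex_quadratic_form_bounds[OF A x(1) sym lo hi])
qed

text \<open>An eigenvalue is the Rayleigh quotient of its eigenvector, so bounds on the form pass to
  it after division by the squared norm.\<close>

lemma eigenvalue_symmetric:
  fixes A :: "real mat"
  assumes A: "A \<in> carrier_mat n n"
    and sym: "\<And>i j. i < n \<Longrightarrow> j < n \<Longrightarrow> A $$ (i, j) = A $$ (j, i)"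
    and lo: "\<And>y. y \<in> carrier_vec n \<Longrightarrow> a * (vnorm2 y)\<^sup>2 \<le> y \<bullet> (A *\<^sub>v y)"
    and hi: "\<And>y. y \<in> carrier_vec n \<Longrightarrow> y \<bullet> (A *\<^sub>v y) \<le> b * (vnorm2 y)\<^sup>2"
    and ev: "eigenvalue (map_mat complex_of_real A) \<alpha>"
  shows "\<alpha> \<in> complex_of_real ` {a..b}"
proof -
  obtain v where v: "v \<in> carrier_vec n" "v \<noteq> 0\<^sub>v n"
      "map_mat complex_of_real A *\<^sub>v v = \<alpha> \<cdot>\<^sub>v v"
    using ev A by (auto simp: eigenvalue_def eigenvector_def)
  obtain r where r: "(map_mat complex_of_real A *\<^sub>v v) \<bullet>c v = complex_of_real r"
    "a * (vnorm2 v)\<^sup>2 \<le> r" "r \<le> b * (vnorm2 v)\<^sup>2"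
    by (rule complex_quadratic_form_bounds[OF A v(1) sym lo hi])
  obtain i where i: "i < n" "v $ i \<noteq> 0"
    using v by (metis carrier_vecD eq_vecI index_zero_vec)
  have pos: "(vnorm2 v)\<^sup>2 > 0"
    unfolding vnorm2_sq using i v(1) by (intro sum_pos2[of _ i]) auto
  have "v \<bullet>c v = complex_of_real ((vnorm2 v)\<^sup>2)"
    using v(1) unfolding vnorm2_sq of_real_sum
    by (auto simp: scalar_prod_def lessThan_atLeast0 cmod_def complex_eq_iff power2_eq_square intro!: sum.cong)
  then have "\<alpha> * complex_of_real ((vnorm2 v)\<^sup>2) = complex_of_real r"
    using r(1) v by simp
  then have "\<alpha> = complex_of_real (r / (vnorm2 v)\<^sup>2)"
    using pos by (simp add: field_simps)
  then show ?thesis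
    using r(2,3) pos by (auto simp: field_simps intro!: image_eqI[of _ _ "r / (vnorm2 v)\<^sup>2"])
qed

text \<open>
  The lower Collatz--Wielandt bound: if the spectral radius were below \<open>r < c\<close>, the powers of
  \<open>A / r\<close> would be bounded, but they expand \<open>x\<close> by at least \<open>(c / r)\<^sup>k\<close>.
\<close>
lemma spectral_radius_ge_nonneg:
  fixes A :: "real mat"
  assumes A: "A \<in> carrier_mat n n"
    and A_nonneg: "\<And>i j. i < n \<Longrightarrow> j < n \<Longrightarrow> A $$ (i, j) \<ge> 0"
    and x_nonneg: "\<And>i. i < n \<Longrightarrow> x i \<ge> 0"
    and p: "p < n" "x p > 0" and c: "c > 0"
    and ge: "\<And>i. i < n \<Longrightarrow> c * x i \<le> (\<Sum>j<n. A $$ (i, j) * x j)"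
  shows "c \<le> spectral_radius (map_mat complex_of_real A)"
proof (rule ccontr)
  let ?C = "map_mat complex_of_real"
  assume "\<not> c \<le> spectral_radius (?C A)"
  \<comment> \<open>The maximum with 0 makes \<open>r\<close> positive even if the spectral radius
    is 0, so that division by \<open>r\<close> is possible.\<close>
  then obtain r where r: "max 0 (spectral_radius (?C A)) < r" "r < c"
    using dense[of "max 0 (spectral_radius (?C A))" c] c by auto
  then have r_pos: "r > 0" by simp
  define T where "T = (1 / r) \<cdot>\<^sub>m A"
  have T: "T \<in> carrier_mat n n" and CT: "?C T \<in> carrier_mat n n" and CA: "?C A \<in> carrier_mat n n"
    using A by (simp_all add: T_def)
  have n: "n > 0" using p by simp
  have "spectral_radius (?C T) < 1"
  proof -
    obtain \<mu> where \<mu>: "eigenvalue (?C T) \<mu>" "spectral_radius (?C T) = cmod \<mu>"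
      using spectral_radius_mem_max(1)[OF CT n] by (auto simp: spectrum_def)
    then obtain v where v: "v \<in> carrier_vec n" "v \<noteq> 0\<^sub>v n" "?C T *\<^sub>v v = \<mu> \<cdot>\<^sub>v v"
      using T by (auto simp: eigenvalue_def eigenvector_def)
    have "?C A = complex_of_real r \<cdot>\<^sub>m ?C T"
      using A r_pos by (intro eq_matI) (auto simp: T_def)
    then have "?C A *\<^sub>v v = complex_of_real r \<cdot>\<^sub>v (?C T *\<^sub>v v)"
      using CT v(1) by (auto simp: scalar_prod_def sum_distrib_left mult_ac intro!: eq_vecI)
    then have "eigenvalue (?C A) (complex_of_real r * \<mu>)"
      using v A by (auto simp: eigenvalue_def eigenvector_def smult_smult_assoc)
    then have "cmod (complex_of_real r * \<mu>) \<le> spectral_radius (?C A)"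
      by (intro spectral_radius_mem_max(2)[OF CA n]) (auto simp: spectrum_def)
    then have "r * cmod \<mu> < r * 1"
      using r r_pos unfolding norm_mult norm_of_real by linarith
    then show ?thesis
      using r_pos \<mu>(2) by (simp only: mult_less_cancel_left_pos)
  qed
  \<comment> \<open>Spectral radius below 1 bounds the entries of all powers uniformly; this is the
    only place where that strict inequality is used.\<close>
  then obtain b where b: "norm_bound (?C T ^\<^sub>m k) b" for k
    using spectral_radius_jnf_norm_bound_less_1_upper_triangular[OF CT] by blast
  have entry_le: "(T ^\<^sub>m k) $$ (i, j) \<le> b" if "i < n" "j < n" for i j k
  proof -
    have "?C (T ^\<^sub>m k) = ?C T ^\<^sub>m k"
      by (rule of_real_hom.mat_hom_pow[OF T])
    then have "cmod (complex_of_real ((T ^\<^sub>m k) $$ (i, j))) \<le> b"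
      using b[of k] that T by (auto simp: norm_bound_def simp flip: \<open>?C (T ^\<^sub>m k) = ?C T ^\<^sub>m k\<close>)
    then show ?thesis by simp
  qed
  have step: "(T ^\<^sub>m Suc k) $$ (i, j) = (\<Sum>l<n. (T ^\<^sub>m k) $$ (i, l) * T $$ (l, j))"
    if "i < n" "j < n" for i j k
    using that T by (simp add: scalar_prod_def lessThan_atLeast0)
  have nonneg: "(T ^\<^sub>m k) $$ (i, j) \<ge> 0" if "i < n" "j < n" for i j k
    using that
  proof (induction k arbitrary: j)
    case 0
    then show ?case using T by simp
  next
    case (Suc k)
    then show ?case
      unfolding step[OF Suc.prems] using A A_nonneg r_pos
      by (intro sum_nonneg mult_nonneg_nonneg) (auto simp: T_def)
  qed
  \<comment> \<open>The inequality A x \<ge> c x can be iterated because the powers of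
    \<open>T\<close> have nonnegative entries and hence preserve it. At the coordinate
    \<open>p\<close> with x p > 0, the growth contradicts the bound \<open>b\<close>.\<close>
  have growth: "(c / r) ^ k * x i \<le> (\<Sum>j<n. (T ^\<^sub>m k) $$ (i, j) * x j)" if i: "i < n" for i k
    using i
  proof (induction k)
    case 0
    then show ?case using T by (simp add: sum.delta if_distrib[of "\<lambda>t. t * _"] cong: if_cong)
  next
    case (Suc k)
    have "(c / r) ^ Suc k * x i = (c / r) * ((c / r) ^ k * x i)"
      by simp
    also have "\<dots> \<le> (c / r) * (\<Sum>l<n. (T ^\<^sub>m k) $$ (i, l) * x l)"
      using Suc c r_pos by (intro mult_left_mono) auto
    also have "\<dots> = (\<Sum>l<n. (T ^\<^sub>m k) $$ (i, l) * (c * x l / r))"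
      by (simp add: sum_distrib_left mult_ac)
    also have "\<dots> \<le> (\<Sum>l<n. (T ^\<^sub>m k) $$ (i, l) * (\<Sum>j<n. T $$ (l, j) * x j))"
    proof (intro sum_mono mult_left_mono)
      fix l assume "l \<in> {..<n}"
      then have l: "l < n" by simp
      show "(T ^\<^sub>m k) $$ (i, l) \<ge> 0"
        using nonneg[OF i l] .
      have "c * x l / r \<le> (\<Sum>j<n. A $$ (l, j) * x j) / r"
        using ge[OF l] r_pos by (intro divide_right_mono) auto
      also have "\<dots> = (\<Sum>j<n. T $$ (l, j) * x j)"
        unfolding sum_divide_distrib using A l by (intro sum.cong) (auto simp: T_def)
      finally show "c * x l / r \<le> (\<Sum>j<n. T $$ (l, j) * x j)" .
    qed
    also have "\<dots> = (\<Sum>j<n. (T ^\<^sub>m Suc k) $$ (i, j) * x j)"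
      unfolding sum_distrib_left
      using i by (subst sum.swap) (simp add: step sum_distrib_right mult.assoc del: pow_mat.simps)
    finally show ?case .
  qed
  have "(c / r) ^ k \<le> b * (\<Sum>j<n. x j) / x p" for k
  proof -
    have "(c / r) ^ k * x p \<le> (\<Sum>j<n. b * x j)"
      using p x_nonneg by (intro order_trans[OF growth] sum_mono mult_right_mono entry_le) auto
    then show ?thesis
      using p by (simp add: sum_distrib_left field_simps)
  qed
  moreover obtain k where "b * (\<Sum>j<n. x j) / x p < (c / r) ^ k"
    using real_arch_pow[of "c / r"] r r_pos by auto
  ultimately show False
    by (simp add: not_less[symmetric])
qed

subsection \<open>The Wasserstein matrix\<close>

lemma wasserstein_mat_carrier [simp]: "wasserstein_mat n lam \<in> carrier_mat n n"
  by (simp add: wasserstein_mat_def)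

lemma wasserstein_mat_dim [simp]:
  "dim_row (wasserstein_mat n lam) = n" "dim_col (wasserstein_mat n lam) = n"
  by (simp_all add: wasserstein_mat_def)

lemma index_wasserstein_mat:
  assumes "i < n" "j < n"
  shows "wasserstein_mat n lam $$ (i, j) = (if j \<le> i then lam ^ (i - j) else lam ^ (j - i))"
  using assms by (auto simp: wasserstein_mat_def nat_diff_distrib intro!: arg_cong[where f = "power lam"])

lemma wasserstein_mat_sym:
  assumes "i < n" "j < n"
  shows "wasserstein_mat n lam $$ (i, j) = wasserstein_mat n lam $$ (j, i)"
  using assms by (auto simp: index_wasserstein_mat)

lemma wasserstein_mat_nonneg:
  assumes "i < n" "j < n" "lam \<ge> 0"
  shows "wasserstein_mat n lam $$ (i, j) \<ge> 0"
  using assms by (simp add: wasserstein_mat_def)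

text \<open>A row consists of two geometric series meeting at the diagonal. The induction fixes
  \<open>i\<close> and appends columns to the right, starting from the row that ends at its diagonal
  entry.\<close>

lemma wasserstein_row_sum:
  assumes i: "i < n"
  shows "(1 - lam) * (\<Sum>j<n. wasserstein_mat n lam $$ (i, j)) = 1 + lam - lam ^ (i + 1) - lam ^ (n - i)"
proof -
  have "(\<Sum>j<n. wasserstein_mat n lam $$ (i, j)) = (\<Sum>j<n. if j \<le> i then lam ^ (i - j) else lam ^ (j - i))"
    using i by (simp add: index_wasserstein_mat)
  moreover have "Suc i \<le> n" using i by simp
  then have "(1 - lam) * (\<Sum>j<n. if j \<le> i then lam ^ (i - j) else lam ^ (j - i))
      = 1 + lam - lam ^ (i + 1) - lam ^ (n - i)"
  proof (induction n rule: dec_induct)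
    case base
    have "(\<Sum>j<Suc i. if j \<le> i then lam ^ (i - j) else lam ^ (j - i)) = (\<Sum>j<Suc i. lam ^ (Suc i - Suc j))"
      by (intro sum.cong) auto
    also have "\<dots> = (\<Sum>j<Suc i. lam ^ j)"
      by (rule sum.nat_diff_reindex)
    finally show ?case
      by (simp only: one_diff_power_eq[symmetric]) simp
  next
    case (step m)
    then show ?case
      by (simp add: Suc_diff_le algebra_simps)
  qed
  ultimately show ?thesis by simp
qed

lemma wasserstein_row_sum_le:
  assumes lam: "0 < lam" "lam < 1" and n: "n \<ge> 2" and i: "i < n"
  shows "(\<Sum>j<n. wasserstein_mat n lam $$ (i, j)) \<le> (1 + lam) * (1 - lam ^ (n - 1)) / (1 - lam)" (is ?A)
    and "(\<Sum>j<n. wasserstein_mat n lam $$ (i, j)) \<le> 1 + 2 * lam * (1 - lam ^ (n - 1)) / (1 - lam)" (is ?B)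
proof -
  have eq: "(\<Sum>j<n. wasserstein_mat n lam $$ (i, j)) = (1 + lam - lam ^ (i + 1) - lam ^ (n - i)) / (1 - lam)"
    using wasserstein_row_sum[OF i, of lam] lam by (simp add: field_simps)
  have dec: "lam ^ b \<le> lam ^ a" if "a \<le> b" for a b
    using lam that by (intro power_decreasing) auto
  have pow: "lam * lam ^ (n - 1) = lam ^ n"
    using n by (cases n) auto
  \<comment> \<open>The two exponents on the right are compared with n - 1 and n in a suitable
    order: in the last row the second one is 1, at most n - 1 since \<open>n \<ge> 2\<close>; in all
    other rows the first one is at most n - 1.\<close>
  have "lam ^ (n - 1) + lam ^ n \<le> lam ^ (i + 1) + lam ^ (n - i)"
  proof (cases "i + 1 = n")
    case True
    then show ?thesis using dec[of "n - i" "n - 1"] n by simp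
  next
    case False
    then have "i + 1 \<le> n - 1" using i by simp
    from dec[OF this] show ?thesis using dec[of "n - i" n] by simp
  qed
  then show ?A
    unfolding eq using lam pow by (intro divide_right_mono) (auto simp: algebra_simps)
  have "1 + 2 * lam * (1 - lam ^ (n - 1)) / (1 - lam) = (1 + lam - 2 * lam ^ n) / (1 - lam)"
    using lam pow by (simp add: field_simps)
  moreover have "lam ^ n \<le> lam ^ (i + 1)" "lam ^ n \<le> lam ^ (n - i)"
    by (rule dec, use i in simp)+
  then have "1 + lam - lam ^ (i + 1) - lam ^ (n - i) \<le> 1 + lam - 2 * lam ^ n"
    by simp
  ultimately show ?B
    unfolding eq using lam by (simp add: divide_right_mono del: add_diff_eq)
qed

text \<open>
  The term \<open>t\<^sup>2 / lam\<close>, with \<open>t\<close> the off-diagonal contribution of the next row, is what makes the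
  bound inductive in \<open>n\<close>.
\<close>
lemma wasserstein_form_lower_aux:
  fixes x :: "nat \<Rightarrow> real"
  assumes lam: "0 < lam" "lam < 1"
  shows "(1 - lam) / (1 + lam) * (\<Sum>i<n. (x i)\<^sup>2) + (\<Sum>j<n. lam ^ (n - j) * x j)\<^sup>2 / lam
    \<le> (\<Sum>i<n. \<Sum>j<n. (if j \<le> i then lam ^ (i - j) else lam ^ (j - i)) * x i * x j)"
proof (induction n)
  case 0
  then show ?case by simp
next
  case (Suc n)
  define F where "F n = (\<Sum>i<n. \<Sum>j<n. (if j \<le> i then lam ^ (i - j) else lam ^ (j - i)) * x i * x j)" for n
  define t where "t n = (\<Sum>j<n. lam ^ (n - j) * x j)" for n
  define s where "s = t n + x n"
  have "t (Suc n) = (\<Sum>j<Suc n. lam * (lam ^ (n - j) * x j))"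
    unfolding t_def by (intro sum.cong) (auto simp: Suc_diff_le)
  then have t_Suc: "t (Suc n) = lam * s"
    by (simp add: s_def t_def distrib_left flip: sum_distrib_left)
  have "(\<Sum>j<n. (if j \<le> n then lam ^ (n - j) else lam ^ (j - n)) * x n * x j) = x n * t n"
    unfolding t_def sum_distrib_left by (intro sum.cong) auto
  moreover have "(\<Sum>i<n. (if n \<le> i then lam ^ (i - n) else lam ^ (n - i)) * x i * x n) = x n * t n"
    unfolding t_def sum_distrib_left by (intro sum.cong) auto
  ultimately have F_Suc: "F (Suc n) = F n + 2 * (x n * t n) + (x n)\<^sup>2"
    by (simp add: F_def sum.distrib power2_eq_square)
  have IH: "(1 - lam) / (1 + lam) * (\<Sum>i<n. (x i)\<^sup>2) + (t n)\<^sup>2 / lam \<le> F n"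
    using Suc.IH by (simp add: F_def t_def)
  \<comment> \<open>The new row adds s^2 - t^2 to the form, and the next correction term is lam s^2.
    Cancelling the factor 1 - lam, the induction step becomes x^2/(1 + lam) \<le> s^2 + t^2/lam with
    x = s - t, a weighted Cauchy-Schwarz inequality.\<close>
  have "(s - t n)\<^sup>2 \<le> (1 + lam) * (s\<^sup>2 + (t n)\<^sup>2 / lam)"
  proof -
    have "(1 + lam) * (s\<^sup>2 + (t n)\<^sup>2 / lam) - (s - t n)\<^sup>2 = (lam * s + t n)\<^sup>2 / lam"
      using lam by (simp add: field_simps power2_eq_square)
    then show ?thesis
      using lam by (smt (verit) divide_nonneg_pos zero_le_power2)
  qed
  then have "(x n)\<^sup>2 / (1 + lam) \<le> s\<^sup>2 + (t n)\<^sup>2 / lam"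
    using lam by (simp add: s_def pos_divide_le_eq mult.commute)
  then have "(1 - lam) * ((x n)\<^sup>2 / (1 + lam)) \<le> (1 - lam) * (s\<^sup>2 + (t n)\<^sup>2 / lam)"
    using lam by (intro mult_left_mono) auto
  also have "(1 - lam) * (s\<^sup>2 + (t n)\<^sup>2 / lam) = s\<^sup>2 - (lam * s)\<^sup>2 / lam + (t n)\<^sup>2 / lam - (t n)\<^sup>2"
    using lam by (simp add: field_simps power2_eq_square)
  also have "s\<^sup>2 = (t n)\<^sup>2 + 2 * (x n * t n) + (x n)\<^sup>2"
    by (simp add: s_def power2_eq_square algebra_simps)
  finally have "(1 - lam) / (1 + lam) * (\<Sum>i<Suc n. (x i)\<^sup>2) + (t (Suc n))\<^sup>2 / lam \<le> F (Suc n)"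
    using IH unfolding F_Suc t_Suc by (simp add: distrib_left)
  then show ?case
    by (simp add: F_def t_def)
qed

lemma wasserstein_form_ge:
  assumes lam: "0 < lam" "lam < 1" and x: "x \<in> carrier_vec n"
  shows "(1 - lam) / (1 + lam) * (vnorm2 x)\<^sup>2 \<le> x \<bullet> (wasserstein_mat n lam *\<^sub>v x)"
proof -
  have "x \<bullet> (wasserstein_mat n lam *\<^sub>v x)
      = (\<Sum>i<n. \<Sum>j<n. (if j \<le> i then lam ^ (i - j) else lam ^ (j - i)) * x $ i * x $ j)"
    unfolding quadratic_form_sum[OF wasserstein_mat_carrier x]
    by (intro sum.cong) (auto simp: index_wasserstein_mat)
  moreover have "(vnorm2 x)\<^sup>2 = (\<Sum>i<n. (x $ i)\<^sup>2)"
    using vnorm2_sq_real[OF x] by simp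
  ultimately show ?thesis
    using lam by (simp only:) (rule order_trans[OF _ wasserstein_form_lower_aux[OF lam]], simp)
qed

text \<open>By symmetry the row-sum bound is also a column-sum bound, so the Schur test gives its
  square, and the root loses nothing.\<close>

lemma wasserstein_vnorm2_le:
  assumes lam: "0 < lam" "lam < 1" and n: "n \<ge> 2" and x: "x \<in> carrier_vec n"
  shows "vnorm2 (wasserstein_mat n lam *\<^sub>v x)
    \<le> (1 + lam) * (1 - lam ^ (n - 1)) / (1 - lam) * vnorm2 x" (is "_ \<le> ?B * _")
proof -
  have abs: "\<bar>wasserstein_mat n lam $$ (i, j)\<bar> = wasserstein_mat n lam $$ (i, j)"
    if "i < n" "j < n" for i j
    using wasserstein_mat_nonneg[OF that, of lam] lam by simp
  have B: "?B \<ge> 0"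
    using lam by (simp add: power_le_one)
  have row: "(\<Sum>j<n. \<bar>wasserstein_mat n lam $$ (i, j)\<bar>) \<le> ?B" if "i < n" for i
    using wasserstein_row_sum_le(1)[OF lam n that] that by (simp add: abs)
  moreover have "(\<Sum>i<n. \<bar>wasserstein_mat n lam $$ (i, j)\<bar>) \<le> ?B" if j: "j < n" for j
  proof -
    have "(\<Sum>i<n. \<bar>wasserstein_mat n lam $$ (i, j)\<bar>) = (\<Sum>i<n. \<bar>wasserstein_mat n lam $$ (j, i)\<bar>)"
      using j by (intro sum.cong arg_cong[where f = abs] wasserstein_mat_sym) auto
    then show ?thesis using row[OF j] by simp
  qed
  ultimately have "(vnorm2 (wasserstein_mat n lam *\<^sub>v x))\<^sup>2 \<le> ?B * ?B * (vnorm2 x)\<^sup>2"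
    using B by (intro schur_test[OF wasserstein_mat_carrier x]) auto
  also have "\<dots> = (?B * vnorm2 x)\<^sup>2"
    by (simp only: power2_eq_square mult_ac)
  finally show ?thesis
    by (rule power2_le_imp_le) (use B vnorm2_nonneg in \<open>intro mult_nonneg_nonneg\<close>)
qed

text \<open>\<open>Q\<close> is the correlation matrix of a stationary first-order autoregressive
  process, and this is its precision matrix: by the Markov property only neighbours interact. The
  two end points have a single neighbour each, hence the different diagonal entry. The formula is
  the inverse only for n \<ge> 2; at n = 1 it gives 1/(1 - lam^2) instead of 1.\<close>

definition wasserstein_inv :: "nat \<Rightarrow> real \<Rightarrow> real mat" where
  "wasserstein_inv n lam = mat n n (\<lambda>(i, j).
     (if i = j then (if i = 0 \<or> Suc i = n then 1 else 1 + lam\<^sup>2)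
      else if Suc i = j \<or> i = Suc j then - lam else 0) / (1 - lam\<^sup>2))"

lemma wasserstein_inv_carrier [simp]: "wasserstein_inv n lam \<in> carrier_mat n n"
  by (simp add: wasserstein_inv_def)

lemma wasserstein_inv_sym:
  "i < n \<Longrightarrow> j < n \<Longrightarrow> wasserstein_inv n lam $$ (i, j) = wasserstein_inv n lam $$ (j, i)"
  by (auto simp: wasserstein_inv_def)

lemma sum_tridiagonal:
  fixes f :: "nat \<Rightarrow> 'a :: comm_ring_1"
  assumes j: "j < n"
  shows "(\<Sum>i<n. f i * (if i = j then d else if Suc i = j \<or> i = Suc j then e else 0))
    = f j * d + (if j > 0 then f (j - 1) * e else 0) + (if Suc j < n then f (Suc j) * e else 0)"
proof -
  \<comment> \<open>For j = 0 the truncated \<open>j - 1\<close> is again 0, so the left neighbour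
    needs the guard \<open>j > 0\<close>.\<close>
  have "(\<Sum>i<n. f i * (if i = j then d else if Suc i = j \<or> i = Suc j then e else 0))
      = (\<Sum>i<n. (if i = j then f i * d else 0)
          + (if i = j - 1 then (if j > 0 then f i * e else 0) else 0) + (if i = Suc j then f i * e else 0))"
    by (intro sum.cong) auto
  also have "\<dots> = f j * d + (if j > 0 then f (j - 1) * e else 0) + (if Suc j < n then f (Suc j) * e else 0)"
    using j by (simp add: sum.distrib)
  finally show ?thesis .
qed

lemma wasserstein_mat_mult_inv:
  assumes lam: "0 < lam" "lam < 1" and n: "n \<ge> 2"
  shows "wasserstein_mat n lam * wasserstein_inv n lam = 1\<^sub>m n"
proof (rule eq_matI)
  fix i j assume "i < dim_row (1\<^sub>m n :: real mat)" "j < dim_col (1\<^sub>m n :: real mat)"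
  then have i: "i < n" and j: "j < n" by auto
  have nz: "1 - lam\<^sup>2 \<noteq> 0"
    using lam by (simp add: power2_eq_1_iff)
  define q where "q k = (if k \<le> i then lam ^ (i - k) else lam ^ (k - i))" for k
  define d where "d = (if j = 0 \<or> Suc j = n then 1 else 1 + lam\<^sup>2)"
  have "(wasserstein_mat n lam * wasserstein_inv n lam) $$ (i, j)
      = (\<Sum>k<n. wasserstein_mat n lam $$ (i, k) * wasserstein_inv n lam $$ (k, j))"
    using i j by (simp add: scalar_prod_def lessThan_atLeast0 wasserstein_inv_def)
  also have "\<dots> = (\<Sum>k<n. q k * (if k = j then d else if Suc k = j \<or> k = Suc j then - lam else 0)) / (1 - lam\<^sup>2)"
    unfolding sum_divide_distrib
    using i j by (intro sum.cong) (auto simp: wasserstein_inv_def index_wasserstein_mat q_def d_def)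
  also have "\<dots> = (q j * d + (if j > 0 then q (j - 1) * - lam else 0)
      + (if Suc j < n then q (Suc j) * - lam else 0)) / (1 - lam\<^sup>2)"
    by (simp only: sum_tridiagonal[OF j])
  also have "\<dots> = (if i = j then 1 else 0)"
  \<comment> \<open>Off the diagonal, lam^d is annihilated by the three-term recurrence (1 + lam^2)
    lam^d = lam (lam^(d-1) + lam^(d+1)), and at an end column by lam^d = lam * lam^(d-1). On the
    diagonal 1 - lam^2 is left over. Writing the distance as \<open>Suc k\<close> removes truncated
    subtractions.\<close>
  proof (cases i j rule: linorder_cases)
    case less
    then obtain k where k: "j = Suc (i + k)"
      using less_imp_Suc_add by blast
    show ?thesis
      using less j n nz by (auto simp: k q_def d_def algebra_simps power2_eq_square)
  next
    case equal
    then show ?thesis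
      using j n nz by (cases j) (auto simp: q_def d_def algebra_simps power2_eq_square)
  next
    case greater
    then obtain k where k: "i = Suc (j + k)"
      using less_imp_Suc_add by blast
    have "Suc (j + k) - (j - Suc 0) = Suc (Suc k)" if "j > 0"
      using that by simp
    then show ?thesis
      using greater i j n nz by (auto simp: k q_def d_def algebra_simps power2_eq_square)
  qed
  finally show "(wasserstein_mat n lam * wasserstein_inv n lam) $$ (i, j) = 1\<^sub>m n $$ (i, j)"
    using i j by simp
qed (simp_all add: wasserstein_inv_def)

text \<open>\<open>mat_inv\<close> unwraps an option, so \<open>None\<close> has to be refuted: a
  right inverse of a square matrix over a field is two-sided, which makes \<open>A\<close> a unit.
  Otherwise uniqueness of inverses applies.\<close>

lemma mat_inv_eqI:
  assumes A: "A \<in> carrier_mat n n" and B: "B \<in> carrier_mat n n" and AB: "A * B = 1\<^sub>m n"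
  shows "mat_inv A = B"
proof (cases "mat_inverse A")
  case None
  have "B * A = 1\<^sub>m n"
    using mat_mult_left_right_inverse[OF A B AB] .
  then have "A \<in> Units (ring_mat TYPE(real) n ())"
    using A B AB by (auto simp: Units_def ring_mat_simps)
  then show ?thesis
    using mat_inverse(1)[OF A None, of "()"] by simp
next
  case (Some C)
  then have C: "C * A = 1\<^sub>m n" "C \<in> carrier_mat n n"
    using mat_inverse(2)[OF A] by auto
  have "C = C * (A * B)"
    using C AB by simp
  also have "\<dots> = (C * A) * B"
    by (rule assoc_mult_mat[OF C(2) A B, symmetric])
  also have "\<dots> = B"
    using B C by simp
  finally show ?thesis
    by (simp add: mat_inv_def Some)
qed

lemma mat_inv_wasserstein_mat:
  assumes "0 < lam" "lam < 1" "n \<ge> 2"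
  shows "mat_inv (wasserstein_mat n lam) = wasserstein_inv n lam"
  by (intro mat_inv_eqI[OF wasserstein_mat_carrier wasserstein_inv_carrier]
      wasserstein_mat_mult_inv assms)

text \<open>The worst column is an interior one, with sum (1 + 2 lam + lam^2)/(1 - lam^2).\<close>

lemma wasserstein_inv_col_sum_le:
  assumes lam: "0 < lam" "lam < 1" and j: "j < n"
  shows "(\<Sum>i<n. \<bar>wasserstein_inv n lam $$ (i, j)\<bar>) \<le> (1 + lam) / (1 - lam)"
proof -
  define d where "d = (if j = 0 \<or> Suc j = n then 1 else 1 + lam\<^sup>2)"
  have pos: "1 - lam\<^sup>2 > 0"
    using lam by (simp add: power_less_one_iff)
  have "(\<Sum>i<n. \<bar>wasserstein_inv n lam $$ (i, j)\<bar>)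
      = (\<Sum>i<n. 1 * (if i = j then d else if Suc i = j \<or> i = Suc j then lam else 0)) / (1 - lam\<^sup>2)"
    unfolding sum_divide_distrib
    using j lam pos by (intro sum.cong) (auto simp: wasserstein_inv_def d_def)
  also have "\<dots> \<le> (1 + lam)\<^sup>2 / (1 - lam\<^sup>2)"
    unfolding sum_tridiagonal[OF j] using lam pos
    by (intro divide_right_mono) (auto simp: d_def power2_eq_square algebra_simps)
  also have "\<dots> = (1 + lam) / (1 - lam)"
  proof -
    have "1 - lam\<^sup>2 = (1 - lam) * (1 + lam)"
      by (simp add: power2_eq_square algebra_simps)
    then show ?thesis
      using lam by (simp add: power2_eq_square)
  qed
  finally show ?thesis .
qed

text \<open>For y the image of x under the inverse, the form of \<open>Q\<close> at y equals y . x.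
  Coercivity bounds it from below by a multiple of |y|^2, Cauchy-Schwarz from above by |y| |x|, and
  one factor |y| cancels.\<close>

lemma wasserstein_inv_vnorm2_le:
  assumes lam: "0 < lam" "lam < 1" and n: "n \<ge> 2" and x: "x \<in> carrier_vec n"
  shows "vnorm2 (wasserstein_inv n lam *\<^sub>v x) \<le> (1 + lam) / (1 - lam) * vnorm2 x"
proof -
  define y where "y = wasserstein_inv n lam *\<^sub>v x"
  have y: "y \<in> carrier_vec n"
    unfolding y_def by (rule mult_mat_vec_carrier[OF wasserstein_inv_carrier x])
  have "wasserstein_mat n lam *\<^sub>v y = wasserstein_mat n lam * wasserstein_inv n lam *\<^sub>v x"
    unfolding y_def using x by (intro assoc_mult_mat_vec[symmetric]) auto
  then have Qy: "wasserstein_mat n lam *\<^sub>v y = x"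
    using x by (simp add: wasserstein_mat_mult_inv[OF lam n])
  have "(1 - lam) / (1 + lam) * (vnorm2 y)\<^sup>2 \<le> vnorm2 y * vnorm2 x"
    using wasserstein_form_ge[OF lam y] cauchy_schwarz_vnorm2[OF y x] by (simp add: Qy)
  then have "vnorm2 y * ((1 - lam) * vnorm2 y) \<le> vnorm2 y * ((1 + lam) * vnorm2 x)"
    using lam by (simp add: field_simps power2_eq_square)
  then have "vnorm2 y = 0 \<or> (1 - lam) * vnorm2 y \<le> (1 + lam) * vnorm2 x"
    using vnorm2_nonneg[of y] by (auto simp: mult_le_cancel_left)
  then have "(1 - lam) * vnorm2 y \<le> (1 + lam) * vnorm2 x"
    using lam vnorm2_nonneg[of x] by auto
  then show ?thesis
    using lam by (simp add: y_def field_simps)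
qed

section \<open>Estimates through the strictly lower triangular part\<close>

lemma wasserstein_form_split:
  fixes x :: "real vec" and lam :: real
  assumes x: "x \<in> carrier_vec n"
  defines "L \<equiv> strict_lower (wasserstein_mat n lam)"
  shows "x \<bullet> (wasserstein_mat n lam *\<^sub>v x) = (vnorm2 x)\<^sup>2 + 2 * (x \<bullet> (L *\<^sub>v x))"
proof -
  have L: "L \<in> carrier_mat n n"
    by (simp add: L_def strict_lower_def)
  have "x \<bullet> (wasserstein_mat n lam *\<^sub>v x)
      = (\<Sum>i<n. \<Sum>j<n. (if i = j then (x $ i)\<^sup>2 else 0) + L $$ (i, j) * x $ i * x $ j + L $$ (j, i) * x $ j * x $ i)"
    unfolding quadratic_form_sum[OF wasserstein_mat_carrier x]
    by (intro sum.cong) (auto simp: L_def strict_lower_def index_wasserstein_mat power2_eq_square)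
  also have "\<dots> = (\<Sum>i<n. (x $ i)\<^sup>2) + x \<bullet> (L *\<^sub>v x) + (\<Sum>i<n. \<Sum>j<n. L $$ (j, i) * x $ j * x $ i)"
    by (simp add: sum.distrib quadratic_form_sum[OF L x])
  also have "(\<Sum>i<n. \<Sum>j<n. L $$ (j, i) * x $ j * x $ i) = x \<bullet> (L *\<^sub>v x)"
    unfolding quadratic_form_sum[OF L x] by (rule sum.swap)
  finally show ?thesis
    using vnorm2_sq_real[OF x] by simp
qed

text \<open>Each application clears one more leading coordinate: after k steps the first k are
  zero.\<close>

lemma strict_lower_funpow_eq_0:
  fixes x :: "real vec"
  assumes A: "A \<in> carrier_mat n n" and x: "x \<in> carrier_vec n"
  shows "((\<lambda>v. strict_lower A *\<^sub>v v) ^^ n) x = 0\<^sub>v n"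
proof -
  have L: "strict_lower A \<in> carrier_mat n n"
    using A by (simp add: strict_lower_def)
  have car: "((\<lambda>v. strict_lower A *\<^sub>v v) ^^ k) x \<in> carrier_vec n" for k
    by (induction k) (use x L in auto)
  have "(((\<lambda>v. strict_lower A *\<^sub>v v) ^^ k) x) $ i = 0" if "i < k" "i < n" for i k
    using that
  proof (induction k arbitrary: i)
    case (Suc k)
    have "((\<lambda>v. strict_lower A *\<^sub>v v) ^^ Suc k) x $ i
        = (\<Sum>j<n. strict_lower A $$ (i, j) * (((\<lambda>v. strict_lower A *\<^sub>v v) ^^ k) x) $ j)"
      by (simp add: index_mult_mat_vec_sum[OF L car Suc.prems(2)] del: index_mult_mat_vec)
    also have "\<dots> = 0"
      using Suc A by (intro sum.neutral) (auto simp: strict_lower_def)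
    finally show ?case .
  qed simp
  then show ?thesis
    using car by (intro eq_vecI) auto
qed

text \<open>With y the transposed image of x, |y|^2 = x . A y \<le> |x| |A| |y|, and |y| cancels.
  This duality replaces singular values.\<close>

lemma vnorm2_transpose_mult_le:
  fixes A :: "real mat"
  assumes A: "A \<in> carrier_mat n n" and x: "x \<in> carrier_vec n"
  shows "vnorm2 (transpose_mat A *\<^sub>v x) \<le> mnorm2 A * vnorm2 x"
proof (cases "vnorm2 (transpose_mat A *\<^sub>v x) = 0")
  case True
  show ?thesis
    using vnorm2_mult_le_mnorm2[OF A x] vnorm2_nonneg[of "A *\<^sub>v x"] True by linarith
next
  case False
  define y where "y = transpose_mat A *\<^sub>v x"
  have y: "y \<in> carrier_vec n"
    using A x by (simp add: y_def)
  have "(vnorm2 y)\<^sup>2 = (transpose_mat A *\<^sub>v x) \<bullet> y"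
    unfolding y_def[symmetric] by (rule vnorm2_sq_real(1)[OF y])
  also have "\<dots> = x \<bullet> (A *\<^sub>v y)"
    using A x y by (metis transpose_vec_mult_scalar transpose_transpose transpose_carrier_mat)
  also have "\<dots> \<le> vnorm2 x * vnorm2 (A *\<^sub>v y)"
    using A x y by (intro cauchy_schwarz_vnorm2) auto
  also have "\<dots> \<le> vnorm2 x * (mnorm2 A * vnorm2 y)"
    by (intro mult_left_mono vnorm2_mult_le_mnorm2[OF A y] vnorm2_nonneg)
  finally have "vnorm2 y * vnorm2 y \<le> vnorm2 y * (mnorm2 A * vnorm2 x)"
    by (simp add: power2_eq_square mult_ac)
  then show ?thesis
    using False vnorm2_nonneg[of y] by (auto simp: y_def mult_le_cancel_left)
qed

lemma vnorm2_triangle: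
  fixes x y :: "real vec"
  assumes "x \<in> carrier_vec n" "y \<in> carrier_vec n"
  shows "vnorm2 (x + y) \<le> vnorm2 x + vnorm2 y"
  using L2_set_triangle_ineq[of "\<lambda>i. x $ i" "\<lambda>i. y $ i" "{..<n}"] assms
  by (simp add: vnorm2_def L2_set_def)

lemma wasserstein_mnorm2_le:
  assumes n: "n > 0"
  shows "mnorm2 (wasserstein_mat n lam) \<le> 1 + 2 * mnorm2 (strict_lower (wasserstein_mat n lam))"
proof -
  define L where "L = strict_lower (wasserstein_mat n lam)"
  have L: "L \<in> carrier_mat n n" "transpose_mat L \<in> carrier_mat n n"
    by (simp_all add: L_def strict_lower_def)
  show ?thesis
    unfolding L_def[symmetric]
  proof (rule mnorm2_le[OF wasserstein_mat_carrier n])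
    fix x :: "real vec" assume x: "x \<in> carrier_vec n"
    have "wasserstein_mat n lam *\<^sub>v x = (x + L *\<^sub>v x) + transpose_mat L *\<^sub>v x"
      using x L unfolding wasserstein_mat_decomp[of n lam, folded L_def]
      by (simp add: add_mult_distrib_mat_vec[of _ n n])
    then have "vnorm2 (wasserstein_mat n lam *\<^sub>v x)
        \<le> vnorm2 x + vnorm2 (L *\<^sub>v x) + vnorm2 (transpose_mat L *\<^sub>v x)"
      using vnorm2_triangle[of x n "L *\<^sub>v x"] x L
        vnorm2_triangle[of "x + L *\<^sub>v x" n "transpose_mat L *\<^sub>v x"] by force
    also have "\<dots> \<le> vnorm2 x + mnorm2 L * vnorm2 x + mnorm2 L * vnorm2 x"
      using vnorm2_mult_le_mnorm2[OF L(1) x] vnorm2_transpose_mult_le[OF L(1) x] by linarith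
    finally show "vnorm2 (wasserstein_mat n lam *\<^sub>v x) \<le> (1 + 2 * mnorm2 L) * vnorm2 x"
      by (simp add: algebra_simps)
  qed
qed

text \<open>For n = 1 the matrix is (1): its spectral radius is below 1 + lam, and the interval
  claimed for the numerical range is empty. Hence \<open>n \<ge> 2\<close>. Membership in an image
  under \<open>complex_of_real\<close> asserts reality as well as the bounds.\<close>

theorem theorem3p1:
  fixes n :: nat and lam :: real and Q L :: "real mat" and QC :: "complex mat"
  assumes n: "n \<ge> 2"
    and lam: "0 < lam" "lam < 1"
    and Q: "Q = wasserstein_mat n lam"
    and L: "L = strict_lower Q"
    and QC: "QC = map_mat complex_of_real Q"
  shows
    "(lam \<le> 1 / 3 \<longrightarrow>
        (\<forall>\<alpha>. eigenvalue QC \<alpha> \<longrightarrow> \<alpha> \<in> complex_of_real ` {0<..<2})) \<and>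
     (\<forall>\<alpha>. eigenvalue QC \<alpha> \<longrightarrow>
        \<alpha> \<in> complex_of_real ` {0<..1 + 2 * mnorm2 L * cos (pi / (real n + 1))}) \<and>
     spectral_radius QC \<ge> 1 + lam \<and>
     numerical_range QC \<subseteq>
       complex_of_real ` {0<..(1 + lam) * (1 - lam ^ (n - 1)) / (1 - lam)} \<and>
     (1 / (1 + lam)\<^sup>2 \<le> mnorm_inf Q \<and> mnorm_inf Q = mnorm1 Q \<and>
        mnorm1 Q \<le> 1 + 2 * lam * (1 - lam ^ (n - 1)) / (1 - lam)) \<and>
     (1 / (1 + lam)\<^sup>2 \<le> mnorm2 Q \<and>
        mnorm2 Q \<le> Min {1 + 2 * mnorm2 L, (3 - lam) / (1 - lam),
                         2 * (1 + lam) * (1 - lam ^ (n - 1)) / (1 - lam)}) \<and>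
     (mnorm_inf (mat_inv Q) = mnorm1 (mat_inv Q) \<and>
        mnorm1 (mat_inv Q) \<ge> (1 - lam) / ((1 + lam) * (1 - lam ^ n)\<^sup>2)) \<and>
     ((1 - lam) / (1 + lam) \<le> mnorm2 (mat_inv Q) \<and>
        mnorm2 (mat_inv Q) \<le> (1 + lam) / (1 - lam)) \<and>
     ((1 - lam) / ((1 + lam) ^ 3 * (1 - lam ^ n)\<^sup>2) \<le> cond_inf Q \<and> cond_inf Q = cond1 Q \<and>
        cond1 Q \<le> (1 + lam) * (1 - lam + 2 * lam * (1 - lam ^ (n - 1))) / (1 - lam)\<^sup>2) \<and>
     ((1 - lam) / (1 + lam) ^ 3 \<le> cond2 Q \<and>
        cond2 Q \<le> (1 + lam) / (1 - lam) *
          Min {1 + 2 * mnorm2 L, (3 - lam) / (1 - lam),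
               2 * (1 + lam) * (1 - lam ^ (n - 1)) / (1 - lam)})"
proof -
  define B where "B = (1 + lam) * (1 - lam ^ (n - 1)) / (1 - lam)"
  define P where "P = mat_inv Q"
  have P: "P = wasserstein_inv n lam"
    unfolding P_def Q using lam n by (rule mat_inv_wasserstein_mat)
  have n0: "n > 0" using n by simp
  have car: "Q \<in> carrier_mat n n" "P \<in> carrier_mat n n" "L \<in> carrier_mat n n"
    by (simp_all add: Q P L strict_lower_def)
  have sym: "Q $$ (i, j) = Q $$ (j, i)" if "i < n" "j < n" for i j
    unfolding Q using that by (rule wasserstein_mat_sym)
  define a where "a = (1 - lam) / (1 + lam)"
  have a: "a > 0"
    using lam by (simp add: a_def)
  have lo: "a * (vnorm2 x)\<^sup>2 \<le> x \<bullet> (Q *\<^sub>v x)" if "x \<in> carrier_vec n" for x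
    unfolding Q a_def using lam that by (rule wasserstein_form_ge)
  have Qx: "vnorm2 (Q *\<^sub>v x) \<le> B * vnorm2 x" if "x \<in> carrier_vec n" for x
    unfolding Q B_def using lam n that by (rule wasserstein_vnorm2_le)
  have hi: "x \<bullet> (Q *\<^sub>v x) \<le> B * (vnorm2 x)\<^sup>2" if x: "x \<in> carrier_vec n" for x
  proof -
    have "x \<bullet> (Q *\<^sub>v x) \<le> vnorm2 x * vnorm2 (Q *\<^sub>v x)"
      using x car by (intro cauchy_schwarz_vnorm2) auto
    also have "\<dots> \<le> vnorm2 x * (B * vnorm2 x)"
      by (intro mult_left_mono Qx x vnorm2_nonneg)
    finally show ?thesis
      by (simp add: power2_eq_square mult_ac)
  qed
  have B_less: "B < (1 + lam) / (1 - lam)"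
    unfolding B_def using lam by (intro divide_strict_right_mono) auto

  have "complex_of_real ` {a..B} \<subseteq> complex_of_real ` {0<..B}"
    using a by (intro image_mono) auto
  then have iv: "numerical_range QC \<subseteq> complex_of_real ` {0<..B}"
    using numerical_range_symmetric[OF car(1) sym lo hi] unfolding QC by blast

  have i: "\<alpha> \<in> complex_of_real ` {0<..<2}" if "lam \<le> 1 / 3" and ev: "eigenvalue QC \<alpha>" for \<alpha>
  proof -
    \<comment> \<open>The threshold 1/3 is exactly where this quotient reaches 2; strictness of the
      final bound comes from \<open>B_less\<close>.\<close>
    have "(1 + lam) / (1 - lam) \<le> 2"
      using that(1) lam by (simp add: field_simps)
    with B_less have "{a..B} \<subseteq> {0<..<2}"
      using a by auto
    then show ?thesis
      using eigenvalue_symmetric[OF car(1) sym lo hi ev[unfolded QC]] by blast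
  qed

  define w where "w = 1 + 2 * mnorm2 L * cos (pi / (real n + 1))"
  have hi': "x \<bullet> (Q *\<^sub>v x) \<le> w * (vnorm2 x)\<^sup>2" if x: "x \<in> carrier_vec n" for x
  proof -
    have "((\<lambda>v. L *\<^sub>v v) ^^ n) x = 0\<^sub>v n"
      unfolding L using car(1) x by (rule strict_lower_funpow_eq_0)
    then have "x \<bullet> (L *\<^sub>v x) \<le> mnorm2 L * cos (pi / (real n + 1)) * (vnorm2 x)\<^sup>2"
      using n vnorm2_mult_le_mnorm2[OF car(3)] mnorm2_nonneg[OF car(3) n0]
      by (intro nilpotent_quadratic_form_le[OF car(3) x])
    then show ?thesis
      using wasserstein_form_split[OF x, of lam] by (simp add: w_def Q L algebra_simps)
  qed
  have ii: "\<alpha> \<in> complex_of_real ` {0<..w}" if ev: "eigenvalue QC \<alpha>" for \<alpha>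
    using eigenvalue_symmetric[OF car(1) sym lo hi' ev[unfolded QC]] a by auto

  have iii: "1 + lam \<le> spectral_radius QC"
    unfolding QC
  \<comment> \<open>Both rows of the leading 2 by 2 block sum to 1 + lam; in the other rows the test
    vector is 0 and nonnegativity of \<open>Q\<close> is enough.\<close>
  proof (rule spectral_radius_ge_nonneg[OF car(1), where x = "\<lambda>i. if i < 2 then 1 else 0" and p = 0])
    fix i assume i: "i < n"
    have "(\<Sum>j<n. Q $$ (i, j) * (if j < 2 then 1 else 0)) = (\<Sum>j<2. Q $$ (i, j))"
      using n by (intro sum.mono_neutral_cong_right) auto
    also have "\<dots> = Q $$ (i, 0) + Q $$ (i, 1)"
      by (simp add: numeral_2_eq_2)
    also have "\<dots> \<ge> (1 + lam) * (if i < 2 then 1 else 0)"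
      using i n lam by (cases "i = 0") (auto simp: Q index_wasserstein_mat less_2_cases_iff)
    finally show "(1 + lam) * (if i < 2 then 1 else 0) \<le> (\<Sum>j<n. Q $$ (i, j) * (if j < 2 then 1 else 0))" .
  qed (use n lam in \<open>auto simp: Q wasserstein_mat_nonneg\<close>)

  have lower: "1 / (1 + lam)\<^sup>2 \<le> 1"
    using lam by simp
  have Q1: "mnorm_inf Q = mnorm1 Q"
    by (rule mnorm_inf_eq_mnorm1[OF car(1) n0 sym])
  have Q1_lower: "1 / (1 + lam)\<^sup>2 \<le> mnorm1 Q"
  proof -
    have "\<bar>Q $$ (0, 0)\<bar> \<le> (\<Sum>i<n. \<bar>Q $$ (i, 0)\<bar>)"
      using n0 by (intro member_le_sum) auto
    then show ?thesis
      using col_sum_le_mnorm1[OF car(1) n0] lower n0 by (simp add: Q index_wasserstein_mat)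
  qed
  have Q1_upper: "mnorm1 Q \<le> 1 + 2 * lam * (1 - lam ^ (n - 1)) / (1 - lam)"
  proof -
    have "\<bar>Q $$ (i, j)\<bar> = Q $$ (j, i)" if "i < n" "j < n" for i j
      using that lam sym[OF that] by (simp add: Q wasserstein_mat_nonneg)
    then show ?thesis
      using wasserstein_row_sum_le(2)[OF lam n, folded Q] by (simp add: mnorm1_le_iff[OF car(1) n0])
  qed

  define U where "U = Min {1 + 2 * mnorm2 L, (3 - lam) / (1 - lam),
    2 * (1 + lam) * (1 - lam ^ (n - 1)) / (1 - lam)}"
  have Q2_lower: "1 / (1 + lam)\<^sup>2 \<le> mnorm2 Q"
    using abs_entry_le_mnorm2[OF car(1) n0 n0] lower n0 by (simp add: Q index_wasserstein_mat)
  have Q2_upper: "mnorm2 Q \<le> U"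
  proof -
    have "mnorm2 Q \<le> B"
      using Qx by (rule mnorm2_le[OF car(1) n0])
    moreover have "0 \<le> B"
      unfolding B_def using lam by (simp add: power_le_one)
    then have "B \<le> 2 * B"
      by simp
    \<comment> \<open>The third candidate in the minimum is twice the Schur bound
      \<open>B\<close>.\<close>
    then have "B \<le> 2 * (1 + lam) * (1 - lam ^ (n - 1)) / (1 - lam)"
      by (simp only: B_def mult.assoc times_divide_eq_right)
    moreover have "(1 + lam) / (1 - lam) \<le> (3 - lam) / (1 - lam)"
      using lam by (intro divide_right_mono) auto
    moreover have "mnorm2 Q \<le> 1 + 2 * mnorm2 L"
      unfolding L Q using n0 by (rule wasserstein_mnorm2_le)
    ultimately show ?thesis
      using B_less by (simp add: U_def)
  qed

  have P1: "mnorm_inf P = mnorm1 P"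
    unfolding P by (rule mnorm_inf_eq_mnorm1[OF wasserstein_inv_carrier n0 wasserstein_inv_sym])
  have P00: "P $$ (0, 0) = 1 / (1 - lam\<^sup>2)"
    using n by (auto simp: P wasserstein_inv_def)
  have sq: "1 - lam\<^sup>2 > 0"
    using lam by (simp add: power_less_one_iff)
  \<comment> \<open>Since n \<ge> 2, lam^n may be replaced by lam^2. The bound then equals 1/((1 +
    lam)^2 (1 - lam^2)), which is below the corner entry of \<open>P\<close>.\<close>
  have P1_lower: "(1 - lam) / ((1 + lam) * (1 - lam ^ n)\<^sup>2) \<le> mnorm1 P"
  proof -
    have "lam ^ n \<le> lam\<^sup>2"
      using lam n by (intro power_decreasing) auto
    then have "(1 - lam\<^sup>2)\<^sup>2 \<le> (1 - lam ^ n)\<^sup>2"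
      using sq by (intro power_mono) auto
    then have "(1 - lam) / ((1 + lam) * (1 - lam ^ n)\<^sup>2) \<le> (1 - lam) / ((1 + lam) * (1 - lam\<^sup>2)\<^sup>2)"
      using lam sq by (intro divide_left_mono mult_left_mono mult_pos_pos) auto
    also have "\<dots> = 1 / ((1 + lam)\<^sup>2 * (1 - lam\<^sup>2))"
    proof -
      have "1 - lam\<^sup>2 = (1 - lam) * (1 + lam)"
        by (simp add: power2_eq_square algebra_simps)
      then show ?thesis
        using lam by (simp add: power2_eq_square)
    qed
    also have "\<dots> \<le> 1 / (1 - lam\<^sup>2)"
    proof -
      have "1 * (1 - lam\<^sup>2) \<le> (1 + lam)\<^sup>2 * (1 - lam\<^sup>2)"
        using lam sq by (intro mult_right_mono one_le_power) auto
      then show ?thesis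
        using lam sq by (intro divide_left_mono mult_pos_pos) auto
    qed
    also have "1 / (1 - lam\<^sup>2) = \<bar>P $$ (0, 0)\<bar>"
      using sq by (simp add: P00)
    also have "\<dots> \<le> (\<Sum>i<n. \<bar>P $$ (i, 0)\<bar>)"
      using n0 member_le_sum[of 0 "{..<n}" "\<lambda>i. \<bar>P $$ (i, 0)\<bar>"] by simp
    also have "\<dots> \<le> mnorm1 P"
      by (rule col_sum_le_mnorm1[OF car(2) n0])
    finally show ?thesis .
  qed
  have P1_upper: "mnorm1 P \<le> (1 + lam) / (1 - lam)"
    using wasserstein_inv_col_sum_le[OF lam, of _ n, folded P] by (simp add: mnorm1_le_iff[OF car(2) n0])
  have P2_lower: "(1 - lam) / (1 + lam) \<le> mnorm2 P"
  proof -
    have "(1 - lam) / (1 + lam) \<le> 1"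
      using lam by simp
    also have "1 \<le> \<bar>P $$ (0, 0)\<bar>"
      using sq by (simp add: P00)
    also have "\<dots> \<le> mnorm2 P"
      by (rule abs_entry_le_mnorm2[OF car(2) n0 n0])
    finally show ?thesis .
  qed
  have P2_upper: "mnorm2 P \<le> (1 + lam) / (1 - lam)"
    using wasserstein_inv_vnorm2_le[OF lam n] by (intro mnorm2_le[OF car(2) n0]) (simp add: P)

  \<comment> \<open>These signs allow the norm bounds to be multiplied; the norms themselves are
    nonnegative because they exceed such a lower bound.\<close>
  have nn: "1 / (1 + lam)\<^sup>2 \<ge> 0" "(1 - lam) / ((1 + lam) * (1 - lam ^ n)\<^sup>2) \<ge> 0"
    "(1 - lam) / (1 + lam) \<ge> 0" "(1 + lam) / (1 - lam) \<ge> 0"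
    using lam by auto
  have ix_lower: "(1 - lam) / ((1 + lam) ^ 3 * (1 - lam ^ n)\<^sup>2) \<le> mnorm1 Q * mnorm1 P"
  proof -
    have "(1 - lam) / ((1 + lam) ^ 3 * (1 - lam ^ n)\<^sup>2)
        = 1 / (1 + lam)\<^sup>2 * ((1 - lam) / ((1 + lam) * (1 - lam ^ n)\<^sup>2))"
      by (simp add: power3_eq_cube power2_eq_square mult_ac)
    also have "\<dots> \<le> mnorm1 Q * mnorm1 P"
      using nn Q1_lower by (intro mult_mono Q1_lower P1_lower) linarith+
    finally show ?thesis .
  qed
  have ix_upper: "mnorm1 Q * mnorm1 P
      \<le> (1 + lam) * (1 - lam + 2 * lam * (1 - lam ^ (n - 1))) / (1 - lam)\<^sup>2"
  proof -
    have "mnorm1 Q * mnorm1 P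
        \<le> (1 + 2 * lam * (1 - lam ^ (n - 1)) / (1 - lam)) * ((1 + lam) / (1 - lam))"
      using nn P1_lower Q1_lower Q1_upper by (intro mult_mono Q1_upper P1_upper) linarith+
    also have "1 + 2 * lam * (1 - lam ^ (n - 1)) / (1 - lam)
        = (1 - lam + 2 * lam * (1 - lam ^ (n - 1))) / (1 - lam)"
      using lam by (simp add: add_divide_distrib)
    finally show ?thesis
      by (simp add: power2_eq_square mult_ac)
  qed
  have x_lower: "(1 - lam) / (1 + lam) ^ 3 \<le> mnorm2 Q * mnorm2 P"
  proof -
    have "(1 - lam) / (1 + lam) ^ 3 = 1 / (1 + lam)\<^sup>2 * ((1 - lam) / (1 + lam))"
      by (simp add: power3_eq_cube power2_eq_square mult_ac)
    also have "\<dots> \<le> mnorm2 Q * mnorm2 P"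
      using nn Q2_lower by (intro mult_mono Q2_lower P2_lower) linarith+
    finally show ?thesis .
  qed
  have x_upper: "mnorm2 Q * mnorm2 P \<le> (1 + lam) / (1 - lam) * U"
    using mult_mono[OF P2_upper Q2_upper nn(4)] nn Q2_lower by (simp add: mult.commute)

  show ?thesis
    unfolding cond_num_def P_def[symmetric] U_def[symmetric] w_def[symmetric] B_def[symmetric]
    using i ii iii iv Q1 Q1_lower Q1_upper Q2_lower Q2_upper P1 P1_lower P2_lower P2_upper
      ix_lower ix_upper x_lower x_upper
    by (intro conjI allI impI) auto
qed

end
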